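(* Let $p$ be a prime, $\mathbf{F}$ a field of characteristic $p$ and $m\ge1$. The ring of vector invariants $\mathbf{F}[m\,V_2]^{SL_2(\mathbf{F}_p)}$ is generated (as an $\mathbf{F}$-algebra) by $\mathcal{S}_m$ and elements from the image of the transfer $\operatorname{Tr}^{SL_2(\mathbf{F}_p)}:\mathbf{F}[m\,V_2]\to\mathbf{F}[m\,V_2]^{SL_2(\mathbf{F}_p)}$.
   Context: $V_2$ is the defining 2-dimensional representation of $SL_2(\mathbf{F}_p)$ over $\mathbf{F}$, with $\mathbf{F}[V_2]=\mathbf{F}[x,y]$, and $SL_2(\mathbf{F}_p)$ acts diagonally on $m\,V_2$ (direct sum of $m$ copies), with $\mathbf{F}[m\,V_2]=\mathbf{F}[x_1,y_1,\dots,x_m,y_m]$, $\{x_i,y_i\}$ being the coordinates on the $i$-th copy; the upper triangular Sylow $p$-subgroup $P$ is generated by an element $\sigma$ acting by $\sigma(x_i)=x_i$, $\sigma(y_i)=y_i+x_i$. The transfer is $\operatorname{Tr}^{SL_2(\mathbf{F}_p)}(f)=\sum_{g\in SL_2(\mathbf{F}_p)}g(f)$. Let $N(y)=y^p-yx^{p-1}$, $L=xN(y)$, $D=N(y)^{p-1}+x^{p(p-1)}$ in $\mathbf{F}[x,y]$ (the Dickson invariants). Let $\nabla_m:\mathbf{F}[x,y]\to\mathbf{F}[m\,V_2]$ be the algebra map $x\mapsto x_1+\dots+x_m$, $y\mapsto y_1+\dots+y_m$, and for $\lambda\in\mathbb{N}^m$ let $\pi_\lambda$ be the projection onto the component of multi-degree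 $\lambda$ (where $x_i,y_i$ have multi-degree the $i$-th unit vector). Put $L_\lambda=\pi_\lambda\nabla_m(L)$, $D_\lambda=\pi_\lambda\nabla_m(D)$. $L_i$ denotes $L_\lambda$ for $\lambda_i=p+1$, $\lambda_j=0$ for $j\ne i$; $L_{ij}$ ($i\neq j$) denotes $L_\lambda$ for $\lambda_i=1$, $\lambda_j=p$ and $\lambda_k=0$ otherwise. Let $u_{ij}=x_iy_j-x_jy_i$, $$\mathcal{D}_m=\Big\{\lambda\in\mathbb{N}^m\ \Big|\ p\text{ divides }\lambda_i\text{ for all }i\text{ and }\sum_{i=1}^m\lambda_i=p(p-1)\Big\},$$ $$\mathcal{S}_m=\{u_{ij}\mid i<j\le m\}\cup\{L_i,L_{ij}\mid i,j\in\{1,\dots,m\},\ i\ne j\}\cup\{D_\lambda\mid\lambda\in\mathcal{D}_m\}.$$ *)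

theory Defs
  imports
    "HOL-Library.Poly_Mapping"
    "HOL-Computational_Algebra.Computational_Algebra"
    "HOL-Analysis.Determinants"
begin

subsection \<open>Multivariate polynomials\<close>

text \<open>
  A polynomial in the variables \<open>'v\<close> is a finitely supported map from exponent vectors
  \<open>'v \<Rightarrow>\<^sub>0 nat\<close> to coefficients; the ring structure on this type is the convolution product
  of \<^theory>\<open>HOL-Library.Poly_Mapping\<close>.
\<close>

type_synonym ('v, 'a) mpoly = "('v \<Rightarrow>\<^sub>0 nat) \<Rightarrow>\<^sub>0 'a"

definition Const :: "'a \<Rightarrow> ('v, 'a::comm_ring_1) mpoly" where
  "Const c = Poly_Mapping.single 0 c"

definition Var :: "'v \<Rightarrow> ('v, 'a::comm_ring_1) mpoly" where
  "Var v = Poly_Mapping.single (Poly_Mapping.single v 1) 1"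

definition vars :: "('v, 'a::comm_ring_1) mpoly \<Rightarrow> 'v set" where
  "vars f = (\<Union>t\<in>Poly_Mapping.keys f. Poly_Mapping.keys t)"

text \<open>The algebra homomorphism determined by \<open>Var v \<mapsto> s v\<close>.\<close>

definition subst ::
  "('v \<Rightarrow> ('w, 'a::comm_ring_1) mpoly) \<Rightarrow> ('v, 'a) mpoly \<Rightarrow> ('w, 'a) mpoly" where
  "subst s f =
     (\<Sum>t\<in>Poly_Mapping.keys f. Const (Poly_Mapping.lookup f t) *
        (\<Prod>v\<in>Poly_Mapping.keys t. s v ^ Poly_Mapping.lookup t v))"

inductive_set generated_algebra :: "('v, 'a::comm_ring_1) mpoly set \<Rightarrow> ('v, 'a) mpoly set"
  for S :: "('v, 'a) mpoly set" where
  const: "Const c \<in> generated_algebra S"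
| gen: "f \<in> S \<Longrightarrow> f \<in> generated_algebra S"
| add: "f \<in> generated_algebra S \<Longrightarrow> g \<in> generated_algebra S \<Longrightarrow> f + g \<in> generated_algebra S"
| mult: "f \<in> generated_algebra S \<Longrightarrow> g \<in> generated_algebra S \<Longrightarrow> f * g \<in> generated_algebra S"


subsection \<open>The group and its action\<close>

text \<open>
  For a field \<open>'a\<close> of characteristic \<open>p\<close> the set \<open>\<int>\<close> (the range of \<^const>\<open>of_int\<close>) is the prime
  field \<open>F\<^sub>p\<close> inside \<open>'a\<close>.
\<close>

definition SL2p :: "('a::field ^ 2 ^ 2) set" where
  "SL2p = {g. (\<forall>i j. g $ i $ j \<in> \<int>) \<and> det g = 1}"

datatype coord = X | Y

text \<open>
  \<open>F[V\<^sub>2] = F[x, y]\<close> has variables \<^typ>\<open>coord\<close>; \<open>F[m V\<^sub>2]\<close> uses the variables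
  \<open>x\<^sub>i = (X, i)\<close> and \<open>y\<^sub>i = (Y, i)\<close> with \<open>1 \<le> i \<le> m\<close>.
\<close>

abbreviation xv :: "nat \<Rightarrow> (coord \<times> nat, 'a::comm_ring_1) mpoly" where
  "xv i \<equiv> Var (X, i)"

abbreviation yv :: "nat \<Rightarrow> (coord \<times> nat, 'a::comm_ring_1) mpoly" where
  "yv i \<equiv> Var (Y, i)"

definition poly_ring :: "nat \<Rightarrow> (coord \<times> nat, 'a::comm_ring_1) mpoly set" where
  "poly_ring m = {f. vars f \<subseteq> UNIV \<times> {1..m}}"

text \<open>
  The action \<open>(g f)(v) = f (g\<^sup>-\<^sup>1 v)\<close> on polynomial functions. Here \<open>y\<^sub>i\<close> is the first and \<open>x\<^sub>i\<close> the
  second coordinate function on the \<open>i\<close>-th copy of \<open>V\<^sub>2\<close>, so that an upper triangular unipotent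
  matrix fixes \<open>x\<^sub>i\<close> and sends \<open>y\<^sub>i\<close> to \<open>y\<^sub>i + c x\<^sub>i\<close>. The coefficients are the entries of \<open>g\<^sup>-\<^sup>1\<close>,
  which is the adjugate of \<open>g\<close> since \<open>det g = 1\<close>.
\<close>

fun act_var :: "'a::field ^ 2 ^ 2 \<Rightarrow> coord \<times> nat \<Rightarrow> (coord \<times> nat, 'a) mpoly" where
  "act_var g (Y, i) = Const (g $ 2 $ 2) * yv i - Const (g $ 1 $ 2) * xv i"
| "act_var g (X, i) = Const (g $ 1 $ 1) * xv i - Const (g $ 2 $ 1) * yv i"

definition act ::
  "'a::field ^ 2 ^ 2 \<Rightarrow> (coord \<times> nat, 'a) mpoly \<Rightarrow> (coord \<times> nat, 'a) mpoly" where
  "act g = subst (act_var g)"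

definition invariants :: "nat \<Rightarrow> (coord \<times> nat, 'a::field) mpoly set" where
  "invariants m = {f \<in> poly_ring m. \<forall>g\<in>SL2p. act g f = f}"

text \<open>\<^const>\<open>SL2p\<close> is finite when \<open>'a\<close> has positive characteristic.\<close>

definition transfer :: "(coord \<times> nat, 'a::field) mpoly \<Rightarrow> (coord \<times> nat, 'a) mpoly" where
  "transfer f = (\<Sum>g\<in>SL2p. act g f)"


subsection \<open>The invariants obtained from the Dickson invariants\<close>

definition dickson_N :: "nat \<Rightarrow> (coord, 'a::field) mpoly" where
  "dickson_N p = Var Y ^ p - Var Y * Var X ^ (p - 1)"

definition dickson_L :: "nat \<Rightarrow> (coord, 'a::field) mpoly" where
  "dickson_L p = Var X * dickson_N p"

definition dickson_D :: "nat \<Rightarrow> (coord, 'a::field) mpoly" where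
  "dickson_D p = dickson_N p ^ (p - 1) + Var X ^ (p * (p - 1))"

definition nabla :: "nat \<Rightarrow> (coord, 'a::field) mpoly \<Rightarrow> (coord \<times> nat, 'a) mpoly" where
  "nabla m = subst (\<lambda>c. \<Sum>i=1..m. Var (c, i))"

definition multidegree :: "(coord \<times> nat \<Rightarrow>\<^sub>0 nat) \<Rightarrow> nat \<Rightarrow> nat" where
  "multidegree t i = Poly_Mapping.lookup t (X, i) + Poly_Mapping.lookup t (Y, i)"

text \<open>
  Multi-degrees \<open>\<lambda> \<in> \<nat>\<^sup>m\<close> are represented by functions on \<open>nat\<close> vanishing outside \<open>{1..m}\<close>.
\<close>

definition multidegree_component ::
  "(nat \<Rightarrow> nat) \<Rightarrow> (coord \<times> nat, 'a::field) mpoly \<Rightarrow> (coord \<times> nat, 'a) mpoly" where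
  "multidegree_component l f =
     (\<Sum>t\<in>{t \<in> Poly_Mapping.keys f. multidegree t = l}.
        Poly_Mapping.single t (Poly_Mapping.lookup f t))"

definition L_component :: "nat \<Rightarrow> nat \<Rightarrow> (nat \<Rightarrow> nat) \<Rightarrow> (coord \<times> nat, 'a::field) mpoly" where
  "L_component p m l = multidegree_component l (nabla m (dickson_L p))"

definition D_component :: "nat \<Rightarrow> nat \<Rightarrow> (nat \<Rightarrow> nat) \<Rightarrow> (coord \<times> nat, 'a::field) mpoly" where
  "D_component p m l = multidegree_component l (nabla m (dickson_D p))"

definition L_single :: "nat \<Rightarrow> nat \<Rightarrow> nat \<Rightarrow> (coord \<times> nat, 'a::field) mpoly" where
  "L_single p m i = L_component p m ((\<lambda>_. 0)(i := p + 1))"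

definition L_pair :: "nat \<Rightarrow> nat \<Rightarrow> nat \<Rightarrow> nat \<Rightarrow> (coord \<times> nat, 'a::field) mpoly" where
  "L_pair p m i j = L_component p m ((\<lambda>_. 0)(i := 1, j := p))"

definition u_inv :: "nat \<Rightarrow> nat \<Rightarrow> (coord \<times> nat, 'a::field) mpoly" where
  "u_inv i j = xv i * yv j - xv j * yv i"

definition D_degrees :: "nat \<Rightarrow> nat \<Rightarrow> (nat \<Rightarrow> nat) set" where
  "D_degrees p m =
     {l. (\<forall>i. i \<notin> {1..m} \<longrightarrow> l i = 0) \<and> (\<forall>i\<in>{1..m}. p dvd l i) \<and> (\<Sum>i=1..m. l i) = p * (p - 1)}"

text \<open>The condition \<open>i \<noteq> j\<close> only concerns \<^const>\<open>L_pair\<close>: the invariant \<open>L\<^sub>1\<close> is included for \<open>m = 1\<close>.\<close>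

definition S_gens :: "nat \<Rightarrow> nat \<Rightarrow> (coord \<times> nat, 'a::field) mpoly set" where
  "S_gens p m =
     {u_inv i j | i j. 1 \<le> i \<and> i < j \<and> j \<le> m} \<union>
     {L_single p m i | i. i \<in> {1..m}} \<union>
     {L_pair p m i j | i j. i \<in> {1..m} \<and> j \<in> {1..m} \<and> i \<noteq> j} \<union>
     D_component p m ` D_degrees p m"

end

(*
Let P be the Sylow p-subgroup generated by sigma and Delta = sigma - 1, so that the transfer from P is
Delta^(p-1).

The P-invariants are spanned by transfers from P and by monomials in the x_i, the u_ij and the norms
N_i = y_i^p - y_i x_i^(p-1). More precisely, a P-invariant in the image of Delta^j is a combination of
transfers and of monomials with at least j factors x_i. This is proved by induction on the multidegree r:
if p does not divide r_i, then Euler's identity r_i f = x_i d_x f + y_i d_y f expresses f by its partial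
derivatives, where d_y f lies in the image of Delta^(j+1) and d_x f is a P-invariant up to an explicit
correction; if p divides r_i > 0, then f = q N_i^k + x_i f' with q and f' of smaller degree.

Let T be the relative transfer from P to G = SL_2(F_p). As the index p^2 - 1 is -1 in F, every G-invariant
is f = - T f, and f is a combination as above. T maps transfers from P to transfers from G and is linear
over the G-invariants. Modulo the u_ij, the invariant L_ij is x_i N_j, and D_lambda for lambda = p b is a
nonzero multiple of N^b + x^(p b), so by induction on the degree only pure monomials in the x_i or in the
N_i with fewer than p - 1 factors remain. These have a nontrivial weight under the torus, so T kills them.
*)
theory Submission
  imports
    Defs
    "HOL-Combinatorics.Multiset_Permutations"
begin

subsection \<open>Polynomials as sums of monomials\<close>

text \<open>The obstacle in Euler's identity: for a P-invariant f with A = d_y f and B = d_x f,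
  neither y_i A nor x_i B is P-invariant by itself, since Delta sends them to x_i A and -x_i A. The
  pair is therefore corrected by some b with Delta b = -A for which y_i A + x_i b is already a known
  combination; what remains is x_i times the P-invariant B - b of smaller degree. Such a b exists
  because products of the y_i supply preimages of products of the x_i under powers of Delta. The
  level j keeps account: A has level j + 1 and the corrected y_i A loses one level, while B - b has
  level j - 1 (for j > 0) and multiplication by x_i regains it. The process stops at j = p - 1,
  where the image of Delta^j consists of transfers; this is precisely where j + 1 ceases to be
  invertible in F. The bound p - 1 has two more sources: it is the order of the torus, so that
  shorter nonempty monomials in the x_i or in the N_i have a nontrivial weight, and x-monomials of
  at least that length are transfers from P.\<close>

lemma poly_mapping_sum_monomials:
  "(\<Sum>t\<in>Poly_Mapping.keys f. Poly_Mapping.single t (Poly_Mapping.lookup f t)) = f"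
proof (rule poly_mapping_eqI)
  fix k
  have "(\<Sum>t\<in>Poly_Mapping.keys f. Poly_Mapping.lookup (Poly_Mapping.single t (Poly_Mapping.lookup f t)) k)
      = (\<Sum>t\<in>Poly_Mapping.keys f. if t = k then Poly_Mapping.lookup f t else 0)"
    by (rule sum.cong) (simp_all add: lookup_single when_def)
  then show "Poly_Mapping.lookup
      (\<Sum>t\<in>Poly_Mapping.keys f. Poly_Mapping.single t (Poly_Mapping.lookup f t)) k = Poly_Mapping.lookup f k"
    by (simp add: lookup_sum in_keys_iff)
qed

lemma poly_mapping_add_induct [case_names zero single add]:
  fixes f :: "'a \<Rightarrow>\<^sub>0 'b::comm_monoid_add"
  assumes "P 0" and "\<And>t c. P (Poly_Mapping.single t c)"
    and "\<And>f g. P f \<Longrightarrow> P g \<Longrightarrow> P (f + g)"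
  shows "P f"
proof -
  have "P (\<Sum>t\<in>A. Poly_Mapping.single t (Poly_Mapping.lookup f t))" if "finite A" for A
    using that by induction (auto intro: assms)
  then show ?thesis
    using finite_keys[of f] by (metis (no_types) poly_mapping_sum_monomials)
qed

lemma Const_0 [simp]: "Const 0 = 0" and Const_1 [simp]: "Const 1 = 1"
  and Const_add: "Const (a + b) = Const a + Const b"
  and Const_uminus: "Const (- a) = - Const a"
  and Const_diff: "Const (a - b) = Const a - Const b"
  and Const_mult: "Const (a * b) = Const a * Const b"
  by (simp_all add: Const_def single_add single_uminus single_diff mult_single)

lemma Const_of_nat: "Const (of_nat n) = of_nat n"
  by (induction n) (simp_all add: Const_add)

lemma Const_power: "Const (a ^ n) = Const a ^ n"
  by (induction n) (simp_all add: Const_mult)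

section \<open>Monomial evaluation and substitution homomorphisms\<close>

definition mon_eval :: "('v \<Rightarrow> 'b::comm_monoid_mult) \<Rightarrow> ('v \<Rightarrow>\<^sub>0 nat) \<Rightarrow> 'b" where
  "mon_eval s t = (\<Prod>v\<in>Poly_Mapping.keys t. s v ^ Poly_Mapping.lookup t v)"

lemma mon_eval_superset:
  "finite A \<Longrightarrow> Poly_Mapping.keys t \<subseteq> A \<Longrightarrow> mon_eval s t = (\<Prod>v\<in>A. s v ^ Poly_Mapping.lookup t v)"
  unfolding mon_eval_def by (rule prod.mono_neutral_left) (auto simp: in_keys_iff)

lemma mon_eval_add: "mon_eval s (t + t') = mon_eval s t * mon_eval s t'"
proof -
  let ?A = "Poly_Mapping.keys t \<union> Poly_Mapping.keys t'"
  have "mon_eval s (t + t') = (\<Prod>v\<in>?A. s v ^ Poly_Mapping.lookup (t + t') v)"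
    by (rule mon_eval_superset) (use keys_add[of t t'] in auto)
  also have "\<dots> = (\<Prod>v\<in>?A. s v ^ Poly_Mapping.lookup t v) * (\<Prod>v\<in>?A. s v ^ Poly_Mapping.lookup t' v)"
    by (simp add: lookup_add power_add prod.distrib)
  finally show ?thesis
    by (simp add: mon_eval_superset[of ?A])
qed

lemma mon_eval_0 [simp]: "mon_eval s 0 = 1"
  by (simp add: mon_eval_def)

lemma mon_eval_single [simp]: "mon_eval s (Poly_Mapping.single v n) = s v ^ n"
  by (cases "n = 0") (simp_all add: mon_eval_def)

lemma subst_eq: "subst s f =
    (\<Sum>t\<in>Poly_Mapping.keys f. Const (Poly_Mapping.lookup f t) * mon_eval s t)"
  by (simp add: subst_def mon_eval_def)

lemma subst_0 [simp]: "subst s 0 = 0"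
  by (simp add: subst_eq)

lemma subst_single: "subst s (Poly_Mapping.single t c) = Const c * mon_eval s t"
  by (cases "c = 0") (simp_all add: subst_eq)

lemma subst_add: "subst s (f + g) = subst s f + subst s g"
  unfolding subst_eq
  by (rule setsum_keys_plus_distrib) (simp_all add: Const_add algebra_simps)

lemma subst_Const [simp]: "subst s (Const c) = Const c"
  by (subst Const_def) (simp add: subst_single)

lemma subst_Var [simp]: "subst s (Var v) = s v"
  by (simp add: Var_def subst_single)

lemma subst_uminus: "subst s (- f) = - subst s f"
  using subst_add[of s f "- f"] by (simp add: eq_neg_iff_add_eq_0 add.commute)

lemma subst_diff: "subst s (f - g) = subst s f - subst s g"
  using subst_add[of s f "- g"] by (simp add: subst_uminus)

lemma subst_sum: "subst s (sum f A) = (\<Sum>a\<in>A. subst s (f a))"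
  by (induction A rule: infinite_finite_induct) (simp_all add: subst_add)

lemma subst_mult: "subst s (f * g) = subst s f * subst s g"
proof (induction f rule: poly_mapping_add_induct)
  case (single t c)
  show ?case
    by (induction g rule: poly_mapping_add_induct)
      (simp_all add: subst_add distrib_left distrib_right mult_single subst_single mon_eval_add Const_mult mult_ac)
qed (simp_all add: subst_add distrib_right)

lemma subst_1 [simp]: "subst s 1 = 1"
  using subst_Const[of s 1] by simp

lemma subst_power: "subst s (f ^ n) = subst s f ^ n"
  by (induction n) (simp_all add: subst_mult)

lemma subst_prod_list: "subst s (prod_list fs) = prod_list (map (subst s) fs)"
  by (induction fs) (simp_all add: subst_mult)

lemmas subst_simps = subst_add subst_diff subst_uminus subst_mult subst_power subst_sum

lemma single_eq_mon_eval: "Poly_Mapping.single t (c::'a::comm_ring_1) = Const c * mon_eval Var t"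
proof -
  have "Poly_Mapping.single t (1::'a) = mon_eval Var t"
  proof (induction t rule: poly_mapping_add_induct)
    case (single v n)
    show ?case
    proof (induction n)
      case (Suc n)
      have "Poly_Mapping.single (Poly_Mapping.single v (Suc n)) (1::'a) =
          Poly_Mapping.single (Poly_Mapping.single v 1) 1 * Poly_Mapping.single (Poly_Mapping.single v n) 1"
        by (simp add: mult_single flip: single_add)
      with Suc show ?case by (simp add: Var_def)
    qed simp
  next
    case (add t t')
    then show ?case
      by (metis mon_eval_add mult.left_neutral mult_single)
  qed simp
  moreover have "Poly_Mapping.single t c = Const c * Poly_Mapping.single t 1"
    by (simp add: Const_def mult_single)
  ultimately show ?thesis by simp
qed

lemma vars_Const [simp]: "vars (Const c) = {}"
  by (auto simp: vars_def Const_def)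

lemma vars_Var_subset: "vars (Var v) \<subseteq> {v}"
  by (auto simp: vars_def Var_def split: if_splits)

lemma vars_add_subset: "vars (f + g) \<subseteq> vars f \<union> vars g"
  using keys_add[of f g] by (auto simp: vars_def)

lemma vars_mult_subset: "vars (f * g) \<subseteq> vars f \<union> vars g"
proof
  fix v assume "v \<in> vars (f * g)"
  then obtain t where t: "t \<in> Poly_Mapping.keys (f * g)" "v \<in> Poly_Mapping.keys t"
    by (auto simp: vars_def)
  then obtain a b where "a \<in> Poly_Mapping.keys f" "b \<in> Poly_Mapping.keys g" "t = a + b"
    using keys_mult[of f g] by auto
  with t show "v \<in> vars f \<union> vars g"
    using keys_add[of a b] by (auto simp: vars_def)
qed

lemma generated_algebra_sum:
  "(\<And>a. a \<in> A \<Longrightarrow> f a \<in> generated_algebra S) \<Longrightarrow> sum f A \<in> generated_algebra S"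
  using generated_algebra.const[of 0 S]
  by (induction A rule: infinite_finite_induct) (auto intro: generated_algebra.add)

lemma generated_algebra_prod:
  "(\<And>a. a \<in> A \<Longrightarrow> f a \<in> generated_algebra S) \<Longrightarrow> prod f A \<in> generated_algebra S"
  using generated_algebra.const[of 1 S]
  by (induction A rule: infinite_finite_induct) (auto intro: generated_algebra.mult)

lemma generated_algebra_power: "f \<in> generated_algebra S \<Longrightarrow> f ^ n \<in> generated_algebra S"
  using generated_algebra.const[of 1 S] by (induction n) (auto intro: generated_algebra.mult)

lemma generated_algebra_uminus: "f \<in> generated_algebra S \<Longrightarrow> - f \<in> generated_algebra S"
  using generated_algebra.mult[OF generated_algebra.const[of "-1" S], of f] by (simp add: Const_uminus)

lemma generated_algebra_diff:
  "f \<in> generated_algebra S \<Longrightarrow> g \<in> generated_algebra S \<Longrightarrow> f - g \<in> generated_algebra S"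
  using generated_algebra.add[OF _ generated_algebra_uminus] by fastforce

text \<open>Recasts the support condition of \<open>poly_ring\<close> as membership in an
  inductively generated algebra, so that closure properties follow by rule induction.\<close>

lemma vars_subset_iff: "vars f \<subseteq> V \<longleftrightarrow> f \<in> generated_algebra (Var ` V)"
proof
  assume *: "vars f \<subseteq> V"
  have "Poly_Mapping.single t (Poly_Mapping.lookup f t) \<in> generated_algebra (Var ` V)"
    if "t \<in> Poly_Mapping.keys f" for t
  proof -
    have "Poly_Mapping.keys t \<subseteq> V"
      using * that by (auto simp: vars_def)
    then show ?thesis
      unfolding single_eq_mon_eval mon_eval_def
      by (intro generated_algebra.mult generated_algebra.const generated_algebra_prod
          generated_algebra_power generated_algebra.gen) auto
  qed
  then show "f \<in> generated_algebra (Var ` V)"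
    using generated_algebra_sum[of "Poly_Mapping.keys f" "\<lambda>t. Poly_Mapping.single t (Poly_Mapping.lookup f t)"]
    by (simp add: poly_mapping_sum_monomials)
next
  assume "f \<in> generated_algebra (Var ` V)"
  then show "vars f \<subseteq> V"
  proof induction
    case (gen f)
    then obtain v where "v \<in> V" "f = Var v" by auto
    then show ?case using vars_Var_subset[of v] by auto
  next
    case (add f g)
    then show ?case using vars_add_subset[of f g] by blast
  next
    case (mult f g)
    then show ?case using vars_mult_subset[of f g] by blast
  qed simp
qed

lemma mpoly_induct [case_names const var add mult]:
  assumes "\<And>c. P (Const c)" "\<And>v. P (Var v)" "\<And>f g. P f \<Longrightarrow> P g \<Longrightarrow> P (f + g)"
    and "\<And>f g. P f \<Longrightarrow> P g \<Longrightarrow> P (f * g)"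
  shows "P f"
proof -
  have "f \<in> generated_algebra (Var ` UNIV)"
    by (simp flip: vars_subset_iff)
  then show ?thesis
    by induction (auto intro: assms)
qed

lemma subst_subst: "subst s (subst s' f) = subst (\<lambda>v. subst s (s' v)) f"
  by (induction f rule: mpoly_induct) (simp_all add: subst_simps)

lemma subst_in_generated_algebra:
  assumes "f \<in> generated_algebra (Var ` V)" "\<And>v. v \<in> V \<Longrightarrow> s v \<in> generated_algebra S"
  shows "subst s f \<in> generated_algebra S"
  using assms(1)
  by induction (auto simp: subst_simps intro: generated_algebra.intros assms(2))

lemma subst_cong_generated:
  assumes "f \<in> generated_algebra (Var ` V)" "\<And>v. v \<in> V \<Longrightarrow> s v = s' v"
  shows "subst s f = subst s' f"
  using assms(1) by induction (auto simp: subst_simps assms(2))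

lemma subst_Var_id: "subst Var f = f"
  by (induction f rule: mpoly_induct) (simp_all add: subst_simps)

lemma Var_mult_lookup:
  "Poly_Mapping.lookup (Var v * f) (Poly_Mapping.single v 1 + t) = Poly_Mapping.lookup f t"
proof (induction f rule: poly_mapping_add_induct)
  case (single t' c)
  then show ?case by (simp add: Var_def mult_single lookup_single when_def)
qed (simp_all add: distrib_left lookup_add)

text \<open>Multiplication by a variable only shifts exponents, so it is injective over any
  coefficient ring. This is how x_i is cancelled without an integral domain at hand.\<close>

lemma Var_mult_cancel: "Var v * f = Var v * g \<Longrightarrow> f = g"
  by (metis Var_mult_lookup poly_mapping_eqI)

subsection \<open>Multidegrees and partial derivatives\<close>

lemma poly_ring_iff: "f \<in> poly_ring m \<longleftrightarrow> f \<in> generated_algebra (Var ` (UNIV \<times> {1..m}))"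
  by (simp add: poly_ring_def vars_subset_iff)

lemma poly_ring_Const [simp]: "Const a \<in> poly_ring m"
  and poly_ring_add [simp]: "f \<in> poly_ring m \<Longrightarrow> g \<in> poly_ring m \<Longrightarrow> f + g \<in> poly_ring m"
  and poly_ring_diff [simp]: "f \<in> poly_ring m \<Longrightarrow> g \<in> poly_ring m \<Longrightarrow> f - g \<in> poly_ring m"
  and poly_ring_uminus [simp]: "f \<in> poly_ring m \<Longrightarrow> - f \<in> poly_ring m"
  and poly_ring_mult [simp]: "f \<in> poly_ring m \<Longrightarrow> g \<in> poly_ring m \<Longrightarrow> f * g \<in> poly_ring m"
  and poly_ring_power [simp]: "f \<in> poly_ring m \<Longrightarrow> f ^ n \<in> poly_ring m"
  and poly_ring_sum: "(\<And>a. a \<in> A \<Longrightarrow> h a \<in> poly_ring m) \<Longrightarrow> sum h A \<in> poly_ring m"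
  and poly_ring_Var [simp]: "i \<in> {1..m} \<Longrightarrow> Var (c, i) \<in> poly_ring m"
  unfolding poly_ring_iff
  by (auto intro: generated_algebra.intros generated_algebra_diff generated_algebra_uminus
      generated_algebra_power generated_algebra_sum)

lemma poly_ring_0 [simp]: "0 \<in> poly_ring m" and poly_ring_1 [simp]: "1 \<in> poly_ring m"
  using poly_ring_Const[of 0] poly_ring_Const[of 1] by simp_all

lemma poly_ring_prod_list: "(\<And>f. f \<in> set fs \<Longrightarrow> f \<in> poly_ring m) \<Longrightarrow> prod_list fs \<in> poly_ring m"
  by (induction fs) auto

lemma poly_ring_subst:
  assumes "f \<in> poly_ring m" "\<And>c i. i \<in> {1..m} \<Longrightarrow> s (c, i) \<in> poly_ring m"
  shows "subst s f \<in> poly_ring m"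
  using assms unfolding poly_ring_iff by (intro subst_in_generated_algebra) auto

definition mhom :: "(nat \<Rightarrow> nat) \<Rightarrow> (coord \<times> nat, 'a::field) mpoly \<Rightarrow> bool" where
  "mhom r f \<longleftrightarrow> (\<forall>t\<in>Poly_Mapping.keys f. multidegree t = r)"

lemma multidegree_add: "multidegree (s + t) = (\<lambda>i. multidegree s i + multidegree t i)"
  by (auto simp: multidegree_def lookup_add)

lemma multidegree_0 [simp]: "multidegree 0 = (\<lambda>_. 0)"
  by (auto simp: multidegree_def)

lemma multidegree_single: "multidegree (Poly_Mapping.single (c, i) n) = (\<lambda>_. 0)(i := n)"
  by (cases c) (auto simp: multidegree_def lookup_single when_def)

lemma mhom_0 [simp]: "mhom r 0"
  by (simp add: mhom_def)

lemma mhom_add: "mhom r f \<Longrightarrow> mhom r g \<Longrightarrow> mhom r (f + g)"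
  using keys_add[of f g] by (auto simp: mhom_def)

lemma mhom_uminus: "mhom r f \<Longrightarrow> mhom r (- f)"
  by (simp add: mhom_def in_keys_iff)

lemma mhom_diff: "mhom r f \<Longrightarrow> mhom r g \<Longrightarrow> mhom r (f - g)"
  using mhom_add[of r f "- g"] by (simp add: mhom_uminus)

lemma mhom_single: "multidegree t = r \<Longrightarrow> mhom r (Poly_Mapping.single t c)"
  by (simp add: mhom_def)

lemma mhom_Const: "mhom (\<lambda>_. 0) (Const c)"
  by (simp add: Const_def mhom_single)

lemma mhom_1: "mhom (\<lambda>_. 0) 1"
  using mhom_Const[of 1] by simp

lemma mhom_Var: "mhom ((\<lambda>_. 0)(i := 1)) (Var (c, i))"
  by (simp add: Var_def mhom_single multidegree_single)

lemma mhom_mult: "mhom r f \<Longrightarrow> mhom s g \<Longrightarrow> mhom (\<lambda>i. r i + s i) (f * g)"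
  using keys_mult[of f g] by (fastforce simp: mhom_def multidegree_add)

lemma mhom_power: "mhom r f \<Longrightarrow> mhom (\<lambda>i. n * r i) (f ^ n)"
  by (induction n) (use mhom_1 mhom_mult in fastforce)+

lemma mhom_Const_mult: "mhom r f \<Longrightarrow> mhom r (Const c * f)"
  using mhom_mult[OF mhom_Const] by fastforce

lemma mhom_induct [consumes 1, case_names zero single add]:
  fixes f :: "(coord \<times> nat, 'a::field) mpoly"
  assumes "mhom r f" and "P 0" and "\<And>t c. multidegree t = r \<Longrightarrow> P (Poly_Mapping.single t c)"
    and add: "\<And>f g. P f \<Longrightarrow> P g \<Longrightarrow> P (f + g)"
  shows "P f"
proof -
  have "P (\<Sum>t\<in>A. Poly_Mapping.single t (Poly_Mapping.lookup f t))"
    if "finite A" "A \<subseteq> Poly_Mapping.keys f" for A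
    using that
  proof induction
    case (insert t A)
    then show ?case using assms(1,3) add by (simp add: mhom_def)
  qed (simp add: assms)
  from this[of "Poly_Mapping.keys f"] show ?thesis
    by (simp add: poly_mapping_sum_monomials)
qed

section \<open>Projection onto a multidegree\<close>

lemma lookup_multidegree_component:
  "Poly_Mapping.lookup (multidegree_component l f) t =
    (if multidegree t = l then Poly_Mapping.lookup f t else 0)"
proof -
  let ?K = "{t \<in> Poly_Mapping.keys f. multidegree t = l}"
  have "Poly_Mapping.lookup (multidegree_component l f) t =
      (\<Sum>t'\<in>?K. if t' = t then Poly_Mapping.lookup f t else 0)"
    unfolding multidegree_component_def lookup_sum
    by (rule sum.cong) (simp_all add: lookup_single when_def)
  then show ?thesis by (auto simp: in_keys_iff)
qed

lemma mc_add: "multidegree_component l (f + g) = multidegree_component l f + multidegree_component l g"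
  and mc_diff: "multidegree_component l (f - g) = multidegree_component l f - multidegree_component l g"
  and mc_0 [simp]: "multidegree_component l 0 = 0"
  by (rule poly_mapping_eqI, simp add: lookup_multidegree_component lookup_add lookup_minus)+

lemma mc_sum: "multidegree_component l (sum h A) = (\<Sum>a\<in>A. multidegree_component l (h a))"
  by (induction A rule: infinite_finite_induct) (simp_all add: mc_add)

lemma mhom_mc: "mhom l (multidegree_component l f)"
  by (auto simp: mhom_def in_keys_iff lookup_multidegree_component split: if_splits)

lemma mc_mhom: "mhom r f \<Longrightarrow> multidegree_component l f = (if r = l then f else 0)"
  by (rule poly_mapping_eqI)
    (auto simp: mhom_def in_keys_iff lookup_multidegree_component)

lemma mc_same: "mhom r f \<Longrightarrow> multidegree_component r f = f"
  by (simp add: mc_mhom)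

lemma poly_ring_mc: "f \<in> poly_ring m \<Longrightarrow> multidegree_component l f \<in> poly_ring m"
proof -
  have "Poly_Mapping.keys (multidegree_component l f) \<subseteq> Poly_Mapping.keys f"
    by (auto simp: in_keys_iff lookup_multidegree_component split: if_splits)
  then show "f \<in> poly_ring m \<Longrightarrow> multidegree_component l f \<in> poly_ring m"
    unfolding poly_ring_def vars_def by blast
qed

lemma mc_mult_mhom:
  assumes "mhom r f"
  shows "multidegree_component (\<lambda>i. r i + s i) (f * g) = f * multidegree_component s g"
proof (induction g rule: poly_mapping_add_induct)
  case (single t c)
  have "(\<lambda>i. r i + multidegree t i) = (\<lambda>i. r i + s i) \<longleftrightarrow> multidegree t = s"
    by (auto simp: fun_eq_iff)
  with mc_mhom[OF mhom_mult[OF assms mhom_single[OF refl, of t c]], of "\<lambda>i. r i + s i"]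
    mc_mhom[OF mhom_single[OF refl, of t c], of s]
  show ?case by auto
qed (simp_all add: mc_add distrib_left)

lemma mc_mult_mhom_0:
  assumes "mhom r f" "l i < r i"
  shows "multidegree_component l (f * g) = 0"
proof (induction g rule: poly_mapping_add_induct)
  case (single t c)
  have "(\<lambda>i. r i + multidegree t i) \<noteq> l"
    using assms(2) by (metis leD le_add1)
  then show ?case using mc_mhom[OF mhom_mult[OF assms(1) mhom_single[OF refl]], of l] by simp
qed (simp_all add: mc_add distrib_left)

lemma mc_Const_mult: "multidegree_component l (Const c * f) = Const c * multidegree_component l f"
  using mc_mult_mhom[OF mhom_Const, of l c f] by simp

lemma mc_mult_mhom_cases:
  assumes "mhom r f"
  obtains "multidegree_component l (f * g) = 0"
  | s where "l = (\<lambda>i. r i + s i)" "multidegree_component l (f * g) = f * multidegree_component s g"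
proof (cases "\<forall>i. r i \<le> l i")
  case True
  then have "l = (\<lambda>i. r i + (l i - r i))" by auto
  with that(2)[of "\<lambda>i. l i - r i"] mc_mult_mhom[OF assms, of "\<lambda>i. l i - r i" g] show thesis by simp
next
  case False
  then show thesis using that(1) mc_mult_mhom_0[OF assms] by (meson not_le)
qed

lemma mc_decompose: "(\<Sum>l\<in>multidegree ` Poly_Mapping.keys f. multidegree_component l f) = f"
proof (rule poly_mapping_eqI)
  fix t
  have "(\<Sum>l\<in>multidegree ` Poly_Mapping.keys f. Poly_Mapping.lookup (multidegree_component l f) t)
      = (\<Sum>l\<in>multidegree ` Poly_Mapping.keys f. if l = multidegree t then Poly_Mapping.lookup f t else 0)"
    by (rule sum.cong) (auto simp: lookup_multidegree_component)
  then show "Poly_Mapping.lookup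
      (\<Sum>l\<in>multidegree ` Poly_Mapping.keys f. multidegree_component l f) t = Poly_Mapping.lookup f t"
    by (auto simp: lookup_sum sum.delta in_keys_iff)
qed

lemma mhom_mon_eval:
  assumes "\<And>c i. mhom ((\<lambda>_. 0)(i := 1)) (s (c, i))"
  shows "mhom (multidegree t) (mon_eval s t)"
proof (induction t rule: poly_mapping_add_induct)
  case zero
  then show ?case using mhom_1 by simp
next
  case (single v n)
  obtain c i where "v = (c, i)" by (cases v)
  moreover have "(\<lambda>j. n * ((\<lambda>_. 0)(i := 1)) j) = (\<lambda>_. 0)(i := n)"
    by auto
  ultimately show ?case using mhom_power[OF assms, of n i c] by (simp add: multidegree_single fun_upd_def)
next
  case (add s t)
  then show ?case by (simp add: multidegree_add mon_eval_add mhom_mult)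
qed

lemma mc_subst:
  assumes "\<And>c i. mhom ((\<lambda>_. 0)(i := 1)) (s (c, i))"
  shows "multidegree_component l (subst s f) = subst s (multidegree_component l f)"
proof (induction f rule: poly_mapping_add_induct)
  case (single t c)
  have "mhom (multidegree t) (subst s (Poly_Mapping.single t c))"
    unfolding subst_single by (intro mhom_Const_mult mhom_mon_eval assms)
  from mc_mhom[OF this, of l] show ?case
    using mc_mhom[OF mhom_single[OF refl, of t c], of l] by simp
qed (simp_all add: mc_add subst_add)

text \<open>Instead of proving the cofactor \<open>g\<close> homogeneous, one replaces it by its
  component of the complementary degree without changing the product.\<close>

lemma mhom_factor:
  assumes "mhom (\<lambda>i. r i + s i) (f * g)" "mhom r f"
  shows "f * g = f * multidegree_component s g"
  using mc_mult_mhom[OF assms(2), of s g] mc_same[OF assms(1)] by simp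

text \<open>Exponents subtract with truncation, so a monomial without \<open>v\<close> keeps its
  exponent vector; its coefficient \<open>of_nat 0\<close> makes the term vanish.\<close>

definition partial :: "'v \<Rightarrow> ('v, 'a::comm_ring_1) mpoly \<Rightarrow> ('v, 'a) mpoly" where
  "partial v f = (\<Sum>t\<in>Poly_Mapping.keys f. Poly_Mapping.single (t - Poly_Mapping.single v 1)
      (of_nat (Poly_Mapping.lookup t v) * Poly_Mapping.lookup f t))"

lemma partial_add: "partial v (f + g) = partial v f + partial v g"
  unfolding partial_def by (rule setsum_keys_plus_distrib) (simp_all add: distrib_left single_add)

lemma partial_0 [simp]: "partial v 0 = 0"
  by (simp add: partial_def)

lemma partial_single: "partial v (Poly_Mapping.single t c) =
    Poly_Mapping.single (t - Poly_Mapping.single v 1) (of_nat (Poly_Mapping.lookup t v) * c)"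
  by (cases "c = 0") (simp_all add: partial_def)

lemma partial_Const [simp]: "partial v (Const c) = 0"
  by (simp add: Const_def partial_single)

lemma partial_Var: "partial v (Var w) = (if v = w then 1 else 0)"
  by (auto simp: Var_def partial_single lookup_single when_def)

lemma partial_uminus: "partial v (- f) = - partial v f"
  using partial_add[of v f "- f"] by (simp add: eq_neg_iff_add_eq_0 add.commute)

lemma partial_diff: "partial v (f - g) = partial v f - partial v g"
  using partial_add[of v f "- g"] by (simp add: partial_uminus)

lemma diff_single_add:
  fixes s t :: "'v \<Rightarrow>\<^sub>0 nat"
  assumes "Poly_Mapping.lookup s v \<noteq> 0"
  shows "s + t - Poly_Mapping.single v 1 = (s - Poly_Mapping.single v 1) + t"
  using assms by (intro poly_mapping_eqI) (auto simp: lookup_add lookup_minus lookup_single when_def)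

lemma partial_mult: "partial v (f * g) = partial v f * g + f * partial v g"
proof (induction f rule: poly_mapping_add_induct)
  case (single s a)
  show ?case
  proof (induction g rule: poly_mapping_add_induct)
    case (single t b)
    let ?e = "Poly_Mapping.single v (1::nat)"
    \<comment> \<open>If \<open>v\<close> does not occur in \<open>s\<close>, the two exponent
      vectors may differ, but both coefficients are then 0.\<close>
    have *: "Poly_Mapping.single (s + t - ?e) (of_nat (Poly_Mapping.lookup s v) * c) =
        Poly_Mapping.single ((s - ?e) + t) (of_nat (Poly_Mapping.lookup s v) * (c :: 'b))"
      for s t :: "'a \<Rightarrow>\<^sub>0 nat" and c
      using diff_single_add[of s v t] by (cases "Poly_Mapping.lookup s v = 0") auto
    show ?case
      using *[of s t "a * b"] *[of t s "a * b"]
      by (simp add: mult_single partial_single lookup_add distrib_left distrib_right single_add mult_ac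
          add.commute[of t s] add.commute[of t "s - _"]) (simp add: add_ac)
  qed (simp_all add: partial_add algebra_simps)
qed (simp_all add: partial_add algebra_simps)

lemma poly_ring_partial: "f \<in> poly_ring m \<Longrightarrow> partial v f \<in> poly_ring m"
  unfolding poly_ring_iff
proof (induction rule: generated_algebra.induct)
  case (gen f)
  then show ?case
    using generated_algebra.const[of 0] generated_algebra.const[of 1] by (auto simp: partial_Var)
qed (use generated_algebra.const[of 0] in
    \<open>auto simp: partial_add partial_mult intro: generated_algebra.intros\<close>)

lemma mhom_partial:
  assumes "mhom r f"
  shows "mhom (r(i := r i - 1)) (partial (c, i) f)"
  using assms
proof (induction rule: mhom_induct)
  case (single t a)
  show ?case
  proof (cases "Poly_Mapping.lookup t (c, i) = 0")
    case False
    have "multidegree (t - Poly_Mapping.single (c, i) 1) = r(i := r i - 1)"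
      using single False
      by (cases c) (auto simp: multidegree_def lookup_minus lookup_single when_def)
    then show ?thesis unfolding partial_single by (rule mhom_single)
  qed (simp add: partial_single)
qed (simp_all add: partial_add mhom_add)

lemma Var_mult_partial_single: "Var v * partial v (Poly_Mapping.single t c) =
    of_nat (Poly_Mapping.lookup t v) * Poly_Mapping.single t (c :: 'a::comm_ring_1)"
proof (cases "Poly_Mapping.lookup t v = 0")
  case False
  then have "Poly_Mapping.single v 1 + (t - Poly_Mapping.single v 1) = t"
    by (intro poly_mapping_eqI) (auto simp: lookup_add lookup_minus lookup_single when_def)
  then show ?thesis by (simp add: Var_def partial_single mult_single flip: single_of_nat)
qed (simp add: partial_single)

lemma euler_identity:
  assumes "mhom r f"
  shows "xv i * partial (X, i) f + yv i * partial (Y, i) f = of_nat (r i) * f"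
  using assms
proof (induction rule: mhom_induct)
  case (single t c)
  then have "r i = Poly_Mapping.lookup t (X, i) + Poly_Mapping.lookup t (Y, i)"
    by (auto simp: multidegree_def)
  then show ?case by (simp add: Var_mult_partial_single distrib_right)
qed (simp_all add: partial_add algebra_simps)

subsection \<open>The difference operator of the Sylow subgroup\<close>

fun sigma_var :: "coord \<times> nat \<Rightarrow> (coord \<times> nat, 'a::field) mpoly" where
  "sigma_var (X, i) = xv i"
| "sigma_var (Y, i) = yv i + xv i"

definition sigma :: "(coord \<times> nat, 'a::field) mpoly \<Rightarrow> (coord \<times> nat, 'a) mpoly" where
  "sigma = subst sigma_var"

definition Delta :: "(coord \<times> nat, 'a::field) mpoly \<Rightarrow> (coord \<times> nat, 'a) mpoly" where
  "Delta f = sigma f - f"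

lemma sigma_simps [simp]: "sigma 0 = 0" "sigma 1 = 1" "sigma (Const c) = Const c"
    "sigma (xv i) = xv i" "sigma (yv i) = yv i + xv i"
  and sigma_add: "sigma (f + g) = sigma f + sigma g"
  and sigma_diff: "sigma (f - g) = sigma f - sigma g"
  and sigma_uminus: "sigma (- f) = - sigma f"
  and sigma_mult: "sigma (f * g) = sigma f * sigma g"
  and sigma_power: "sigma (f ^ n) = sigma f ^ n"
  by (simp_all add: sigma_def subst_simps)

lemma sigma_of_nat [simp]: "sigma (of_nat n) = of_nat n"
  by (metis Const_of_nat sigma_simps(3))

lemma sigma_prod_list: "sigma (prod_list fs) = prod_list (map sigma fs)"
  by (simp add: sigma_def subst_prod_list)

lemma sigma_eq: "sigma f = f + Delta f"
  by (simp add: Delta_def)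

lemma Delta_0 [simp]: "Delta 0 = 0"
  and Delta_add: "Delta (f + g) = Delta f + Delta g"
  and Delta_diff: "Delta (f - g) = Delta f - Delta g"
  and Delta_uminus: "Delta (- f) = - Delta f"
  and Delta_mult: "Delta (f * g) = Delta f * g + sigma f * Delta g"
  and sigma_Delta: "sigma (Delta f) = Delta (sigma f)"
  by (simp_all add: Delta_def sigma_add sigma_diff sigma_uminus sigma_mult algebra_simps)

lemma Delta_eq_0_iff: "Delta f = 0 \<longleftrightarrow> sigma f = f"
  by (simp add: Delta_def)

lemma Dn_0 [simp]: "(Delta ^^ n) 0 = 0"
  by (induction n) simp_all

lemma Dn_add: "(Delta ^^ n) (f + g) = (Delta ^^ n) f + (Delta ^^ n) g"
  by (induction n) (simp_all add: Delta_add)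

lemma Dn_diff: "(Delta ^^ n) (f - g) = (Delta ^^ n) f - (Delta ^^ n) g"
  by (induction n) (simp_all add: Delta_diff)

lemma Dn_uminus: "(Delta ^^ n) (- f) = - (Delta ^^ n) f"
  by (induction n) (simp_all add: Delta_uminus)

lemma Dn_sigma: "(Delta ^^ n) (sigma f) = sigma ((Delta ^^ n) f)"
  by (induction n) (simp_all add: sigma_Delta)

lemma Dn_Dn: "(Delta ^^ k) ((Delta ^^ n) f) = (Delta ^^ (k + n)) f"
  by (simp add: funpow_add)

lemma Dn_mult_invariant: "sigma a = a \<Longrightarrow> (Delta ^^ n) (a * f) = a * (Delta ^^ n) f"
  by (induction n) (simp_all add: Delta_mult Delta_eq_0_iff[THEN iffD2])

lemma Dn_Const_mult: "(Delta ^^ n) (Const c * f) = Const c * (Delta ^^ n) f"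
  by (simp add: Dn_mult_invariant)

lemma poly_ring_sigma: "f \<in> poly_ring m \<Longrightarrow> sigma f \<in> poly_ring m"
  unfolding sigma_def 
proof (erule poly_ring_subst)
  show "i \<in> {1..m} \<Longrightarrow> sigma_var (c, i) \<in> poly_ring m" for c i
    by (cases c) simp_all
qed

lemma poly_ring_Dn: "f \<in> poly_ring m \<Longrightarrow> (Delta ^^ n) f \<in> poly_ring m"
  by (induction n) (simp_all add: Delta_def poly_ring_sigma)

lemma mhom_sigma_var: "mhom ((\<lambda>_. 0)(i := 1)) (sigma_var (c, i))"
  by (cases c) (simp_all del: One_nat_def add: mhom_Var mhom_add)

lemma mc_Delta: "multidegree_component l (Delta f) = Delta (multidegree_component l f)"
  unfolding Delta_def sigma_def mc_diff by (simp add: mc_subst mhom_sigma_var del: One_nat_def)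

lemma mc_Dn: "multidegree_component l ((Delta ^^ n) f) = (Delta ^^ n) (multidegree_component l f)"
  by (induction n) (simp_all add: mc_Delta)

lemma mhom_Dn: "mhom r f \<Longrightarrow> mhom r ((Delta ^^ n) f)"
  by (metis mc_Dn mc_same mhom_mc)

lemma mhom_sigma: "mhom r f \<Longrightarrow> mhom r (sigma f)"
  unfolding sigma_eq using mhom_Dn[of r f 1] by (simp add: mhom_add)

lemma partial_Y_sigma: "partial (Y, i) (sigma f) = sigma (partial (Y, i) f)"
proof (induction f rule: mpoly_induct)
  case (var v)
  obtain c k where "v = (c, k)" by (cases v)
  then show ?case by (cases c) (simp_all add: partial_Var partial_add)
qed (simp_all add: partial_add partial_mult sigma_add sigma_mult algebra_simps)

text \<open>Chain rule for y_i -> y_i + x_i: the image of y_i also depends on x_i, whence the d_y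
  term. This term is what spoils the P-invariance of d_x f.\<close>

lemma partial_X_sigma:
  "partial (X, i) (sigma f) = sigma (partial (X, i) f) + sigma (partial (Y, i) f)"
proof (induction f rule: mpoly_induct)
  case (var v)
  obtain c k where "v = (c, k)" by (cases v)
  then show ?case by (cases c) (simp_all add: partial_Var partial_add)
qed (simp_all add: partial_add partial_mult sigma_add sigma_mult algebra_simps)

lemma partial_Y_Dn: "partial (Y, i) ((Delta ^^ n) f) = (Delta ^^ n) (partial (Y, i) f)"
  by (induction n) (simp_all add: Delta_def partial_diff partial_Y_sigma)

text \<open>Iterating d_x Delta = Delta d_x + sigma d_y, where sigma and d_y commute with Delta,
  produces n equal correction terms. For \<open>n = 0\<close> the truncated exponent
  \<open>n - 1\<close> is masked by the factor 0.\<close>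

lemma partial_X_Dn: "partial (X, i) ((Delta ^^ n) f) =
    (Delta ^^ n) (partial (X, i) f) + of_nat n * sigma ((Delta ^^ (n - 1)) (partial (Y, i) f))"
proof (induction n)
  case (Suc n)
  let ?x = "partial (X, i) f" and ?y = "partial (Y, i) f"
  have "partial (X, i) (Delta ((Delta ^^ n) f)) =
      Delta (partial (X, i) ((Delta ^^ n) f)) + sigma ((Delta ^^ n) ?y)"
    by (simp add: Delta_def[of "(Delta ^^ n) f"] Delta_def[of "partial _ _"] partial_diff
        partial_X_sigma partial_Y_Dn)
  also have "\<dots> = (Delta ^^ Suc n) ?x + of_nat n * Delta (sigma ((Delta ^^ (n - 1)) ?y)) + sigma ((Delta ^^ n) ?y)"
    using Suc Dn_mult_invariant[of "of_nat n" 1] by (simp add: Delta_add)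
  also have "of_nat n * Delta (sigma ((Delta ^^ (n - 1)) ?y)) = of_nat n * sigma ((Delta ^^ n) ?y)"
    by (cases n) (simp_all add: sigma_Delta)
  finally show ?case by (simp add: algebra_simps)
qed simp

text \<open>A twisted Leibniz rule. As Delta y_i = x_i and Delta x_i = 0, at most one Delta can fall
  on y_i, and each of the \<open>Suc n\<close> choices gives the same term; sigma enters because
  Delta is a difference operator and not a derivation.\<close>

lemma Dn_yv_mult: "(Delta ^^ Suc n) (yv i * h) =
    yv i * (Delta ^^ Suc n) h + of_nat (Suc n) * (xv i * sigma ((Delta ^^ n) h))"
proof (induction n)
  case 0
  show ?case by (simp add: Delta_def sigma_mult algebra_simps)
next
  case (Suc n)
  have *: "Delta (yv i * f) = yv i * Delta f + xv i * sigma f" for f :: "(coord \<times> nat, 'a) mpoly"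
    by (simp add: Delta_def sigma_mult algebra_simps)
  have **: "Delta (of_nat k * (xv i * f)) = of_nat k * (xv i * Delta f)"
    for k and f :: "(coord \<times> nat, 'a) mpoly"
    by (simp add: Delta_def sigma_mult algebra_simps)
  have "(Delta ^^ Suc (Suc n)) (yv i * h) = Delta ((Delta ^^ Suc n) (yv i * h))"
    by simp
  also have "\<dots> = yv i * (Delta ^^ Suc (Suc n)) h + xv i * sigma ((Delta ^^ Suc n) h)
      + of_nat (Suc n) * (xv i * sigma ((Delta ^^ Suc n) h))"
    unfolding Suc Delta_add * ** by (simp add: sigma_Delta)
  finally show ?case by (simp add: algebra_simps)
qed

subsection \<open>Invariants of the Sylow subgroup\<close>

text \<open>The orbit product of y_i under P: in characteristic p it equals the product of the y_i +
  c x_i over all c in F_p.\<close>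

definition N_inv :: "nat \<Rightarrow> nat \<Rightarrow> (coord \<times> nat, 'a::field) mpoly" where
  "N_inv p i = yv i ^ p - yv i * xv i ^ (p - 1)"

abbreviation x_prod :: "nat list \<Rightarrow> (coord \<times> nat, 'a::field) mpoly" where
  "x_prod is \<equiv> prod_list (map xv is)"

abbreviation u_prod :: "(nat \<times> nat) list \<Rightarrow> (coord \<times> nat, 'a::field) mpoly" where
  "u_prod us \<equiv> prod_list (map (\<lambda>(i, k). u_inv i k) us)"

abbreviation N_prod :: "nat \<Rightarrow> nat list \<Rightarrow> (coord \<times> nat, 'a::field) mpoly" where
  "N_prod p js \<equiv> prod_list (map (N_inv p) js)"

text \<open>
  The first rule yields the transfers from the Sylow subgroup, since \<open>Tr\<^sup>P = \<Delta>\<^sup>p\<^sup>-\<^sup>1\<close>. The filtration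
  by \<open>j\<close> mirrors the images of the powers \<open>\<Delta>\<^sup>j\<close>, and it is what makes the induction on the degree
  go through.
\<close>

inductive_set sylow_span :: "nat \<Rightarrow> nat \<Rightarrow> nat \<Rightarrow> (coord \<times> nat, 'a::field) mpoly set"
  for p m j :: nat where
  tr: "h \<in> poly_ring m \<Longrightarrow> (Delta ^^ (p - 1)) h \<in> sylow_span p m j"
| mon: "set xs \<subseteq> {1..m} \<Longrightarrow> set us \<subseteq> {1..m} \<times> {1..m} \<Longrightarrow> set js \<subseteq> {1..m} \<Longrightarrow> j \<le> length xs \<Longrightarrow>
    Const c * x_prod xs * u_prod us * N_prod p js \<in> sylow_span p m j"
| add: "f \<in> sylow_span p m j \<Longrightarrow> g \<in> sylow_span p m j \<Longrightarrow> f + g \<in> sylow_span p m j"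

lemma sigma_u_inv [simp]: "sigma (u_inv i k) = u_inv i k"
  by (simp add: u_inv_def sigma_diff sigma_mult algebra_simps)

lemma u_inv_swap: "u_inv k i = - u_inv i k" and u_inv_same [simp]: "u_inv i i = 0"
  by (simp_all add: u_inv_def algebra_simps)

lemma poly_ring_u_inv [simp]: "i \<in> {1..m} \<Longrightarrow> k \<in> {1..m} \<Longrightarrow> u_inv i k \<in> poly_ring m"
  by (simp add: u_inv_def)

lemma poly_ring_N_inv [simp]: "i \<in> {1..m} \<Longrightarrow> N_inv p i \<in> poly_ring m"
  by (simp add: N_inv_def)

lemma mhom_u_inv: "mhom (\<lambda>l. ((\<lambda>_. 0)(i := 1)) l + ((\<lambda>_. 0)(k := 1)) l) (u_inv i k)"
  unfolding u_inv_def mult.commute[of "xv k"]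
  by (intro mhom_diff mhom_mult mhom_Var)

lemma mhom_N_inv:
  assumes "p \<ge> 1"
  shows "mhom ((\<lambda>_. 0)(i := p)) (N_inv p i)"
proof -
  have eq: "(\<lambda>l. n * ((\<lambda>_. 0)(i := 1)) l) = (\<lambda>_. 0)(i := n)" for n :: nat
    by auto
  have "mhom ((\<lambda>_. 0)(i := p)) (yv i ^ p)"
    using mhom_power[OF mhom_Var[of i Y], of p] unfolding eq .
  moreover have "mhom ((\<lambda>_. 0)(i := p)) (yv i * xv i ^ (p - 1))"
  proof -
    have "(\<lambda>l. ((\<lambda>_. 0)(i := 1)) l + ((\<lambda>_. 0)(i := p - 1)) l) = (\<lambda>_. 0)(i := p)"
      using assms by auto
    with mhom_mult[OF mhom_Var[of i Y] mhom_power[OF mhom_Var[of i X], of "p - 1", unfolded eq]]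
    show ?thesis by (simp only:)
  qed
  ultimately show ?thesis unfolding N_inv_def by (rule mhom_diff)
qed

lemma mhom_prod_list: "\<forall>f\<in>set fs. \<exists>r. mhom r f \<Longrightarrow> \<exists>r. mhom r (prod_list fs)"
proof (induction fs)
  case Nil
  then show ?case using mhom_1 by auto
next
  case (Cons f fs)
  then obtain r s where "mhom r f" "mhom s (prod_list fs)" by auto
  then show ?case using mhom_mult by fastforce
qed

lemma mhom_x_prod: "\<exists>r. mhom r (x_prod xs)"
  by (rule mhom_prod_list) (use mhom_Var in force)

lemma mhom_u_prod: "\<exists>r. mhom r (u_prod us)"
  by (rule mhom_prod_list) (use mhom_u_inv in force)

lemma mhom_N_prod: "p \<ge> 1 \<Longrightarrow> \<exists>r. mhom r (N_prod p js)"
  by (rule mhom_prod_list) (use mhom_N_inv in force)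

locale prime_char =
  fixes p m :: nat and ty :: "'a::field itself"
  assumes prime_p: "prime p" and char_p: "CHAR('a) = p"
begin

lemma p_ge_2: "p \<ge> 2"
  using prime_p prime_ge_2_nat by blast

lemma of_nat_eq_0: "(of_nat n :: 'a) = 0 \<longleftrightarrow> p dvd n"
  using of_nat_eq_0_iff_char_dvd[where 'a = 'a] char_p by simp

lemma of_nat_p_mpoly: "(of_nat p :: ('v, 'a) mpoly) = 0"
  by (metis Const_0 Const_of_nat dvd_refl of_nat_eq_0)

lemma of_nat_p1_mpoly: "(of_nat (p - 1) :: ('v, 'a) mpoly) = - 1"
  using of_nat_p_mpoly p_ge_2 by (simp add: of_nat_diff)

lemma CHAR_mpoly: "CHAR(('v, 'a) mpoly) = p"
proof (rule CHAR_eqI)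
  show "of_nat p = (0 :: ('v, 'a) mpoly)" by (rule of_nat_p_mpoly)
  fix n assume "of_nat n = (0 :: ('v, 'a) mpoly)"
  then have "Poly_Mapping.single 0 (of_nat n :: 'a) = (0 :: ('v, 'a) mpoly)"
    by (simp add: Const_of_nat flip: Const_def)
  then have "(of_nat n :: 'a) = 0"
    by (metis lookup_single_eq lookup_zero)
  then show "p dvd n" by (simp add: of_nat_eq_0)
qed

lemma frobenius_add: "(f + g) ^ p = f ^ p + (g :: ('v, 'a) mpoly) ^ p"
  by (rule freshmans_dream) (simp_all add: CHAR_mpoly prime_p)

lemma frobenius_sum: "(sum f A) ^ p = (\<Sum>a\<in>A. (f a :: ('v, 'a) mpoly) ^ p)"
  by (rule freshmans_dream_sum) (simp_all add: CHAR_mpoly prime_p)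

lemma sigma_N_inv [simp]: "sigma (N_inv p i) = (N_inv p i :: (coord \<times> nat, 'a) mpoly)"
proof -
  have "(xv i :: (coord \<times> nat, 'a) mpoly) ^ p = xv i * xv i ^ (p - 1)"
    using p_ge_2 by (metis Suc_diff_1 less_le_trans pos2 power_Suc)
  then show ?thesis
    by (simp add: N_inv_def sigma_diff sigma_mult sigma_power frobenius_add algebra_simps)
qed

abbreviation G :: "nat \<Rightarrow> (coord \<times> nat, 'a) mpoly set" where "G \<equiv> sylow_span p m"
abbreviation R :: "(coord \<times> nat, 'a) mpoly set" where "R \<equiv> poly_ring m"

lemma sigma_products [simp]: "sigma (x_prod xs) = (x_prod xs :: (coord \<times> nat, 'a) mpoly)"
    "sigma (u_prod us) = (u_prod us :: (coord \<times> nat, 'a) mpoly)"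
    "sigma (N_prod p js) = (N_prod p js :: (coord \<times> nat, 'a) mpoly)"
  by (simp_all add: sigma_prod_list o_def case_prod_unfold)

lemma poly_ring_products: "set xs \<subseteq> {1..m} \<Longrightarrow> x_prod xs \<in> R"
    "set us \<subseteq> {1..m} \<times> {1..m} \<Longrightarrow> u_prod us \<in> R" "set js \<subseteq> {1..m} \<Longrightarrow> N_prod p js \<in> R"
  by (auto intro!: poly_ring_prod_list simp: subset_iff)

lemma G_Const_mult: "f \<in> G j \<Longrightarrow> Const c * f \<in> G j"
proof (induction rule: sylow_span.induct)
  case (tr h)
  then show ?case using sylow_span.tr[of "Const c * h" m p j] by (simp add: Dn_Const_mult)
next
  case (mon xs us js c')
  then show ?case using sylow_span.mon[of xs m us js j "c * c'" p] by (simp add: Const_mult mult.assoc)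
qed (simp add: distrib_left sylow_span.add)

lemma G_0 [simp]: "0 \<in> G j"
  using sylow_span.tr[of 0 m p j] by simp

lemma G_uminus: "f \<in> G j \<Longrightarrow> - f \<in> G j"
  using G_Const_mult[of f j "-1"] by (simp add: Const_uminus)

lemma G_diff: "f \<in> G j \<Longrightarrow> g \<in> G j \<Longrightarrow> f - g \<in> G j"
  using sylow_span.add[OF _ G_uminus] by fastforce

lemma G_x_mult: "f \<in> G j \<Longrightarrow> i \<in> {1..m} \<Longrightarrow> xv i * f \<in> G (Suc j)"
proof (induction rule: sylow_span.induct)
  case (tr h)
  then show ?case using sylow_span.tr[of "xv i * h" m p "Suc j"] by (simp add: Dn_mult_invariant)
next
  case (mon xs us js c)
  then show ?case using sylow_span.mon[of "i # xs" m us js "Suc j" c p] by (simp add: mult_ac)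
qed (simp add: distrib_left sylow_span.add)

lemma G_N_mult: "f \<in> G j \<Longrightarrow> i \<in> {1..m} \<Longrightarrow> N_inv p i * f \<in> G j"
proof (induction rule: sylow_span.induct)
  case (tr h)
  then show ?case using sylow_span.tr[of "N_inv p i * h" m p j] by (simp add: Dn_mult_invariant)
next
  case (mon xs us js c)
  then show ?case using sylow_span.mon[of xs m us "i # js" j c p] by (simp add: mult_ac)
qed (simp add: distrib_left sylow_span.add)

lemma G_u_mult: "f \<in> G j \<Longrightarrow> i \<in> {1..m} \<Longrightarrow> k \<in> {1..m} \<Longrightarrow> u_inv i k * f \<in> G j"
proof (induction rule: sylow_span.induct)
  case (tr h)
  then show ?case using sylow_span.tr[of "u_inv i k * h" m p j] by (simp add: Dn_mult_invariant)
next
  case (mon xs us js c)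
  then show ?case using sylow_span.mon[of xs m "(i, k) # us" js j c p] by (simp add: mult_ac)
qed (simp add: distrib_left sylow_span.add)

lemma G_N_power_mult: "f \<in> G j \<Longrightarrow> i \<in> {1..m} \<Longrightarrow> N_inv p i ^ k * f \<in> G j"
  by (induction k) (simp_all add: G_N_mult mult.assoc)

lemma G_uN_mult:
  assumes "f \<in> G j" "set us \<subseteq> {1..m} \<times> {1..m}" "set js \<subseteq> {1..m}"
  shows "Const c * u_prod us * N_prod p js * f \<in> G j"
proof -
  have "N_prod p js * f \<in> G j"
    using assms(3) by (induction js) (simp_all add: assms(1) G_N_mult mult.assoc)
  then have "u_prod us * (N_prod p js * f) \<in> G j"
    using assms(2) by (induction us) (auto simp: G_u_mult mult.assoc)
  then show ?thesis by (simp add: G_Const_mult mult.assoc)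
qed

lemma G_antimono: "f \<in> G k \<Longrightarrow> j \<le> k \<Longrightarrow> f \<in> G j"
proof (induction rule: sylow_span.induct)
  case (mon xs us js c)
  then show ?case by (intro sylow_span.mon) auto
qed (simp_all only: sylow_span.tr sylow_span.add)

lemma G_mc: "f \<in> G j \<Longrightarrow> multidegree_component l f \<in> G j"
proof (induction rule: sylow_span.induct)
  case (tr h)
  then show ?case unfolding mc_Dn by (intro sylow_span.tr poly_ring_mc)
next
  case (mon xs us js c)
  have p1: "p \<ge> 1" using p_ge_2 by simp
  obtain r1 r2 r3 where "mhom r1 (x_prod xs :: (coord \<times> nat, 'a) mpoly)"
      "mhom r2 (u_prod us :: (coord \<times> nat, 'a) mpoly)" "mhom r3 (N_prod p js :: (coord \<times> nat, 'a) mpoly)"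
    using mhom_x_prod mhom_u_prod mhom_N_prod[OF p1] by metis
  then have "mhom (\<lambda>i. r1 i + r2 i + r3 i) (Const c * x_prod xs * u_prod us * N_prod p js)"
    by (intro mhom_mult mhom_Const_mult)
  then show ?case using sylow_span.mon[OF mon, of c p] by (simp add: mc_mhom)
qed (simp add: mc_add sylow_span.add)

section \<open>Preimages under powers of the difference operator\<close>

lemma of_nat_mpoly_inverse:
  assumes "\<not> p dvd n"
  shows "Const (1 / of_nat n :: 'a) * of_nat n = (1 :: ('v, 'a) mpoly)"
  using assms by (metis Const_1 Const_mult Const_of_nat nonzero_divide_eq_eq of_nat_eq_0)

lemma not_dvd_small: "0 < k \<Longrightarrow> k < p \<Longrightarrow> \<not> p dvd k"
  by (simp add: nat_dvd_not_less)

text \<open>\<open>V\<close> is the product of the y_i over \<open>xs\<close> divided by k!, where k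
  = \<open>length xs\<close>; k! is invertible as k < p. The second claim serves
  \<open>lift\<close>: x_i times the primitive Delta^(k-1) V of the x-product differs from y_i times
  that product by an element of level k - 1. The factor k makes this true at k = 0, where the
  bracket is y_i - x_i and not P-invariant.\<close>

lemma ladder:
  assumes "length xs < p" "set xs \<subseteq> {1..m}"
  shows "\<exists>V\<in>R. (Delta ^^ length xs) V = x_prod xs \<and>
    (\<forall>i\<in>{1..m}. of_nat (length xs) * (yv i * x_prod xs - xv i * (Delta ^^ (length xs - 1)) V)
      \<in> G (length xs - 1))"
  using assms
proof (induction xs)
  case Nil
  show ?case by (rule bexI[of _ 1]) simp_all
next
  case (Cons l xs)
  let ?k = "length xs"
  let ?P = "x_prod xs :: (coord \<times> nat, 'a) mpoly"
  have l: "l \<in> {1..m}" and xs: "set xs \<subseteq> {1..m}" using Cons.prems by auto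
  from Cons obtain V where V: "V \<in> R" "(Delta ^^ ?k) V = ?P"
    and G: "\<And>i. i \<in> {1..m} \<Longrightarrow> of_nat ?k * (yv i * ?P - xv i * (Delta ^^ (?k - 1)) V) \<in> G (?k - 1)"
    by auto
  define a :: "(coord \<times> nat, 'a) mpoly" where "a = Const (1 / of_nat (Suc ?k) :: 'a)"
  have a: "a * of_nat (Suc ?k) = (1 :: (coord \<times> nat, 'a) mpoly)"
    unfolding a_def
    by (rule of_nat_mpoly_inverse, rule not_dvd_small) (use Cons.prems(1) in simp_all)
  define V' where "V' = a * (yv l * V)"
  have "V' \<in> R" using V l by (simp add: V'_def a_def)
  have Dk: "(Delta ^^ Suc ?k) V = 0"
    using V(2) by (simp add: Delta_eq_0_iff)
  have "(Delta ^^ Suc ?k) V' = a * (of_nat (Suc ?k) * (xv l * ?P))"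
    using V(2) Dk unfolding V'_def a_def Dn_Const_mult Dn_yv_mult by simp
  also have "\<dots> = xv l * ?P" by (simp only: mult.assoc[symmetric] a mult_1_left)
  finally have 1: "(Delta ^^ Suc ?k) V' = x_prod (l # xs)" by simp
  have D': "(Delta ^^ ?k) V' = a * (yv l * ?P + of_nat ?k * (xv l * ((Delta ^^ (?k - 1)) V + ?P)))"
  proof (cases ?k)
    case 0
    then show ?thesis using V(2) unfolding V'_def a_def Dn_Const_mult by simp
  next
    case (Suc n)
    have "sigma ((Delta ^^ n) V) = (Delta ^^ n) V + ?P"
      using V(2) unfolding sigma_eq Suc by simp
    then show ?thesis
      using V(2) unfolding V'_def a_def Dn_Const_mult Suc Dn_yv_mult by simp
  qed
  have 2: "of_nat (Suc ?k) * (yv i * x_prod (l # xs) - xv i * (Delta ^^ ?k) V') \<in> G ?k"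
    if i: "i \<in> {1..m}" for i
  proof -
    let ?W = "(Delta ^^ (?k - 1)) V"
    have "of_nat (Suc ?k) * (yv i * x_prod (l # xs) - xv i * (Delta ^^ ?k) V')
      = of_nat (Suc ?k) * (yv i * x_prod (l # xs)) -
        (a * of_nat (Suc ?k)) * (xv i * (yv l * ?P + of_nat ?k * (xv l * (?W + ?P))))"
      unfolding D' by (simp add: algebra_simps)
    \<comment> \<open>One copy of y_i x_l - x_i y_l gives \<open>u_inv l i\<close>; the other k
      copies of y_i x_l form x_l times the induction hypothesis. The last term stems from sigma = 1
      + Delta, which added \<open>?P\<close> to \<open>?W\<close>.\<close>
    also have "\<dots> = u_inv l i * ?P + xv l * (of_nat ?k * (yv i * ?P - xv i * ?W))
        - Const (of_nat ?k) * (xv i * (xv l * ?P))"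
      unfolding a by (simp add: u_inv_def Const_of_nat algebra_simps)
    also have "\<dots> \<in> G ?k"
    proof (intro G_diff sylow_span.add G_Const_mult)
      have P: "?P \<in> G ?k"
        using sylow_span.mon[of xs m "[]" "[]" ?k 1 p] xs by simp
      then show "u_inv l i * ?P \<in> G ?k" by (rule G_u_mult[OF _ l i])
      show "xv i * (xv l * ?P) \<in> G ?k"
        using G_x_mult[OF G_x_mult[OF P l] i] by (rule G_antimono) simp
      show "xv l * (of_nat ?k * (yv i * ?P - xv i * ?W)) \<in> G ?k"
        using G_x_mult[OF G[OF i] l] by (rule G_antimono) simp
    qed
    finally show ?thesis .
  qed
  show ?case
    by (rule bexI[OF _ \<open>V' \<in> R\<close>]) (use 1 2 in simp)
qed

text \<open>\<open>ladder\<close> reaches length p - 1 at most; the remaining x-factors are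
  P-invariant and pass through Delta.\<close>

lemma long_x_prod_transfer:
  assumes "set xs \<subseteq> {1..m}" "p - 1 \<le> length xs"
  shows "\<exists>h\<in>R. x_prod xs = (Delta ^^ (p - 1)) h"
proof -
  have sub: "set (take (p - 1) xs) \<subseteq> {1..m}" "set (drop (p - 1) xs) \<subseteq> {1..m}"
    using assms(1) set_take_subset[of "p - 1" xs] set_drop_subset[of "p - 1" xs] by auto
  have len: "length (take (p - 1) xs) = p - 1" "p - 1 < p" using assms(2) p_ge_2 by auto
  obtain V where V: "V \<in> R" "(Delta ^^ (p - 1)) V = x_prod (take (p - 1) xs)"
    using ladder[of "take (p - 1) xs"] sub(1) len by auto
  have "x_prod xs = x_prod (drop (p - 1) xs) * (x_prod (take (p - 1) xs) :: (coord \<times> nat, 'a) mpoly)"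
    by (subst append_take_drop_id[of "p - 1" xs, symmetric])
      (simp only: map_append prod_list.append mult.commute)
  also have "\<dots> = (Delta ^^ (p - 1)) (x_prod (drop (p - 1) xs) * V)"
    unfolding Dn_mult_invariant[OF sigma_products(1)] V(2) ..
  finally show ?thesis using poly_ring_products(1)[OF sub(2)] V(1) by auto
qed

text \<open>Here the corrected expression is itself a transfer, that of
  \<open>yv i * h + xv i * h\<close>: as p - 1 = -1 in F, the twisted Leibniz rule turns the first
  summand into y_i A - x_i (Delta^(p-2) h + A), and the second one removes the extra x_i A.\<close>

lemma lift_transfer:
  assumes h: "h \<in> R" and j: "Suc j < p" and i: "i \<in> {1..m}" and A: "A = (Delta ^^ (p - 1)) h"
  shows "\<exists>b\<in>R. Delta ((Delta ^^ (j - 1)) b) = - A \<and> yv i * A + xv i * (Delta ^^ (j - 1)) b \<in> G j"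
proof (rule bexI)
  let ?n = "p - 2"
  \<comment> \<open>Chosen so that Delta^(j-1) \<open>?b\<close> is -Delta^(p-2) h;
    \<open>Suc j < p\<close> keeps the subtraction of exponents from truncating.\<close>
  let ?b = "- (Delta ^^ (?n - (j - 1))) h"
  have p1: "p - 1 = Suc ?n" using p_ge_2 by simp
  have b: "(Delta ^^ (j - 1)) ?b = - (Delta ^^ ?n) h"
    using j unfolding Dn_uminus Dn_Dn by simp
  have D1: "Delta ((Delta ^^ (j - 1)) ?b) = - A"
    unfolding b A p1 by (simp add: Delta_uminus)
  have "(Delta ^^ (p - 1)) (yv i * h + xv i * h) =
      yv i * A + of_nat (Suc ?n) * (xv i * sigma ((Delta ^^ ?n) h)) + xv i * A"
    unfolding A Dn_add Dn_mult_invariant[OF sigma_simps(4)] unfolding p1 Dn_yv_mult ..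
  also have "\<dots> = yv i * A - xv i * sigma ((Delta ^^ ?n) h) + xv i * A"
    unfolding of_nat_p1_mpoly[unfolded p1] by simp
  also have "sigma ((Delta ^^ ?n) h) = (Delta ^^ ?n) h + A"
    unfolding sigma_eq A p1 by simp
  also have "yv i * A - xv i * ((Delta ^^ ?n) h + A) + xv i * A = yv i * A + xv i * (Delta ^^ (j - 1)) ?b"
    unfolding b by (simp add: algebra_simps)
  finally have "yv i * A + xv i * (Delta ^^ (j - 1)) ?b \<in> G j"
    using sylow_span.tr[of "yv i * h + xv i * h" m p j] h i by simp
  with D1 show "Delta ((Delta ^^ (j - 1)) ?b) = - A \<and> yv i * A + xv i * (Delta ^^ (j - 1)) ?b \<in> G j"
    by simp
  show "?b \<in> R" using h by (simp add: poly_ring_Dn)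
qed

text \<open>Supplies the correction that makes y_i A a P-invariant, at the cost of one level. The
  correction lies in the image of Delta^(j-1), so that subtracting it from d_x f leaves something
  the induction can treat. For \<open>j = 0\<close> the truncated exponent is 0 and b itself is a
  primitive of -A.\<close>

lemma lift:
  assumes "A \<in> G (Suc j)" and j: "Suc j < p" and i: "i \<in> {1..m}"
  shows "\<exists>b\<in>R. Delta ((Delta ^^ (j - 1)) b) = - A \<and> yv i * A + xv i * (Delta ^^ (j - 1)) b \<in> G j"
  using assms(1)
proof (induction rule: sylow_span.induct)
  case (tr h)
  then show ?case using lift_transfer[OF _ j i] by blast
next
  case (add f g)
  then obtain b c where "b \<in> R" "Delta ((Delta ^^ (j - 1)) b) = - f"
      "yv i * f + xv i * (Delta ^^ (j - 1)) b \<in> G j"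
      "c \<in> R" "Delta ((Delta ^^ (j - 1)) c) = - g"
      "yv i * g + xv i * (Delta ^^ (j - 1)) c \<in> G j" by auto
  moreover from this have "(yv i * f + xv i * (Delta ^^ (j - 1)) b)
      + (yv i * g + xv i * (Delta ^^ (j - 1)) c) \<in> G j"
    using sylow_span.add by blast
  ultimately show ?case
    by (intro bexI[of _ "b + c"]) (simp_all add: Dn_add Delta_add algebra_simps)
next
  case (mon xs us js c)
  define w where "w = Const c * u_prod us * (N_prod p js :: (coord \<times> nat, 'a) mpoly)"
  have w: "sigma w = w" "w \<in> R"
    using mon poly_ring_products by (simp_all add: w_def sigma_mult)
  have A: "Const c * x_prod xs * u_prod us * N_prod p js = w * x_prod xs"
    by (simp add: w_def mult_ac)
  show ?case
  proof (cases "p - 1 \<le> length xs")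
    case True
    then obtain h where "h \<in> R" "x_prod xs = (Delta ^^ (p - 1)) h"
      using long_x_prod_transfer mon(1) by blast
    then have "w * h \<in> R" "w * x_prod xs = (Delta ^^ (p - 1)) (w * h)"
      using w by (simp_all add: Dn_mult_invariant)
    then show ?thesis unfolding A using lift_transfer[OF _ j i] by blast
  next
    case False
    let ?k = "length xs"
    \<comment> \<open>By \<open>mon(4)\<close>, k \<ge> j + 1 > 0: so the factor k in
      \<open>ladder\<close> can be divided out, and its level k - 1 is at least j.\<close>
    have k: "?k < p" "\<not> p dvd ?k" using False mon(4) not_dvd_small[of ?k] by linarith+
    obtain V where V: "V \<in> R" "(Delta ^^ ?k) V = x_prod xs"
      and G: "of_nat ?k * (yv i * x_prod xs - xv i * (Delta ^^ (?k - 1)) V) \<in> G (?k - 1)"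
      using ladder[OF k(1) mon(1)] i by blast
    have "Const (1 / of_nat ?k) * (of_nat ?k * (yv i * x_prod xs - xv i * (Delta ^^ (?k - 1)) V)) \<in> G (?k - 1)"
      by (rule G_Const_mult[OF G])
    then have "yv i * x_prod xs - xv i * (Delta ^^ (?k - 1)) V \<in> G (?k - 1)"
      by (simp only: mult.assoc[symmetric] of_nat_mpoly_inverse[OF k(2)] mult_1_left)
    then have "yv i * x_prod xs - xv i * (Delta ^^ (?k - 1)) V \<in> G j"
      using G_antimono mon(4) by fastforce
    then have Gw: "w * (yv i * x_prod xs - xv i * (Delta ^^ (?k - 1)) V) \<in> G j"
      unfolding w_def using G_uN_mult mon by blast
    let ?b = "- (w * (Delta ^^ (?k - 1 - (j - 1))) V)"
    have b: "(Delta ^^ (j - 1)) ?b = - (w * (Delta ^^ (?k - 1)) V)"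
      using mon(4) w by (simp add: Dn_uminus Dn_mult_invariant Dn_Dn)
    have "Delta (w * (Delta ^^ (?k - 1)) V) = w * Delta ((Delta ^^ (?k - 1)) V)"
      using Dn_mult_invariant[OF w(1), of 1] by simp
    also have "Delta ((Delta ^^ (?k - 1)) V) = x_prod xs"
      using V(2) mon(4) by (cases ?k) auto
    finally have D1: "Delta ((Delta ^^ (j - 1)) ?b) = - (w * x_prod xs)"
      unfolding b Delta_uminus by simp
    have "yv i * (w * x_prod xs) + xv i * (Delta ^^ (j - 1)) ?b \<in> G j"
      using Gw unfolding b by (simp add: algebra_simps)
    with D1 show ?thesis unfolding A
      by (intro bexI[of _ ?b]) (simp_all add: w V poly_ring_Dn)
  qed
qed

end

section \<open>Division by a power of a norm\<close>

definition rho_var :: "nat \<Rightarrow> coord \<times> nat \<Rightarrow> (coord \<times> nat, 'a::field) mpoly" where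
  "rho_var i v = (if v = (X, i) then 0 else if v = (Y, i) then 1 else Var v)"

lemma sigma_rho: "sigma (subst (rho_var i) f) = subst (rho_var i) (sigma f)"
  unfolding sigma_def subst_subst
proof (rule arg_cong[of _ _ "\<lambda>s. subst s f"], rule ext)
  fix v show "subst sigma_var (rho_var i v) = subst (rho_var i) (sigma_var v)"
    by (cases v rule: sigma_var.cases) (simp_all add: rho_var_def subst_simps)
qed

lemma Dn_rho: "(Delta ^^ n) (subst (rho_var i) f) = subst (rho_var i) ((Delta ^^ n) f)"
  by (induction n) (simp_all add: Delta_def sigma_rho subst_diff)

lemma poly_ring_rho: "f \<in> poly_ring m \<Longrightarrow> subst (rho_var i) f \<in> poly_ring m"
  by (erule poly_ring_subst) (simp add: rho_var_def)

lemma mhom_rho: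
  assumes "mhom r f"
  shows "mhom (r(i := 0)) (subst (rho_var i) f)"
proof -
  have mon: "mhom ((multidegree t)(i := 0)) (mon_eval (rho_var i) t :: (coord \<times> nat, 'a) mpoly)" for t
  proof (induction t rule: poly_mapping_add_induct)
    case zero
    have "(\<lambda>_. 0)(i := 0) = (\<lambda>_. 0 :: nat)" by auto
    then show ?case using mhom_1 by (simp only: multidegree_0 mon_eval_0)
  next
    case (single v n)
    obtain c k where v: "v = (c, k)" by (cases v)
    show ?case
    proof (cases "k = i")
      case True
      then have "mon_eval (rho_var i) (Poly_Mapping.single v n) \<in> {0, 1 :: (coord \<times> nat, 'a) mpoly}"
        by (cases c; cases n) (auto simp: v rho_var_def)
      moreover have "(multidegree (Poly_Mapping.single v n))(i := 0) = (\<lambda>_. 0)"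
        using True by (auto simp: v multidegree_single)
      ultimately show ?thesis using mhom_1 mhom_0 by auto
    next
      case False
      have 1: "mon_eval (rho_var i) (Poly_Mapping.single v n) = (Var (c, k) ^ n :: (coord \<times> nat, 'a) mpoly)"
        using False by (simp add: v rho_var_def)
      have 2: "(multidegree (Poly_Mapping.single v n))(i := 0) = (\<lambda>l. n * ((\<lambda>_. 0)(k := 1)) l)"
        using False by (auto simp: v multidegree_single)
      show ?thesis unfolding 1 2 by (rule mhom_power[OF mhom_Var])
    qed
  next
    case (add s t)
    have "(multidegree (s + t))(i := 0) = (\<lambda>l. ((multidegree s)(i := 0)) l + ((multidegree t)(i := 0)) l)"
      by (auto simp: multidegree_add)
    then show ?case using mhom_mult[OF add] by (simp only: mon_eval_add)
  qed
  show ?thesis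
    using assms
  proof (induction rule: mhom_induct)
    case (single t c)
    show ?case unfolding subst_single single[symmetric] by (rule mhom_Const_mult[OF mon])
  qed (simp_all add: subst_add mhom_add)
qed

text \<open>Setting x_i = 0 is reduction modulo x_i, whereas \<open>rho_var\<close> also sets y_i =
  1. On elements homogeneous in the i-th pair the two differ by a power of y_i;
  \<open>rho_var\<close> is the one that lowers the degree, as the later induction requires.\<close>

definition tau_var :: "nat \<Rightarrow> coord \<times> nat \<Rightarrow> (coord \<times> nat, 'a::field) mpoly" where
  "tau_var i v = (if v = (X, i) then 0 else Var v)"

lemma tau_eq_rho:
  assumes "mhom r f"
  shows "subst (tau_var i) f = subst (rho_var i) f * yv i ^ r i"
proof -
  have mon: "mon_eval (tau_var i) t = (mon_eval (rho_var i) t :: (coord \<times> nat, 'a) mpoly) * yv i ^ multidegree t i" for t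
  proof (induction t rule: poly_mapping_add_induct)
    case (single v n)
    obtain c k where v: "v = (c, k)" by (cases v)
    then show ?case
      by (cases c; cases n) (auto simp: tau_var_def rho_var_def multidegree_single)
  next
    case (add s t)
    then show ?case by (simp add: mon_eval_add multidegree_add power_add mult_ac)
  qed simp
  show ?thesis
    using assms
  proof (induction rule: mhom_induct)
    case (single t c)
    then show ?case by (auto simp: subst_single mon mult_ac)
  qed (simp_all add: subst_add distrib_right)
qed

lemma tau_congruent:
  assumes "f \<in> poly_ring m"
  shows "\<exists>h\<in>poly_ring m. f = subst (tau_var i) f + xv i * h"
  using assms unfolding poly_ring_iff
proof (induction rule: generated_algebra.induct)
  case (const c)
  show ?case by (intro bexI[of _ 0]) (simp_all flip: poly_ring_iff)
next
  case (gen f)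
  then obtain c k where f: "f = Var (c, k)" by auto
  show ?case
  proof (cases "(c, k) = (X, i)")
    case True
    then show ?thesis by (intro bexI[of _ 1]) (simp_all add: f tau_var_def flip: poly_ring_iff)
  next
    case False
    then show ?thesis by (intro bexI[of _ 0]) (auto simp: f tau_var_def simp flip: poly_ring_iff)
  qed
next
  case (add f g)
  then obtain h k where h: "h \<in> poly_ring m" "f = subst (tau_var i) f + xv i * h"
    "k \<in> poly_ring m" "g = subst (tau_var i) g + xv i * k"
    by blast
  have "f + g = subst (tau_var i) (f + g) + xv i * (h + k)"
    by (subst (1) h(2), subst (1) h(4)) (simp add: subst_add algebra_simps)
  then show ?case using h unfolding poly_ring_iff[symmetric] by (intro bexI[of _ "h + k"]) simp_all
next
  case (mult f g)
  then obtain h k where h: "h \<in> poly_ring m" "f = subst (tau_var i) f + xv i * h"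
    "k \<in> poly_ring m" "g = subst (tau_var i) g + xv i * k"
    by blast
  let ?h = "h * g + (f - xv i * h) * k"
  have *: "subst (tau_var i) f = f - xv i * h" "subst (tau_var i) g = g - xv i * k"
    using h by (metis add_diff_cancel_right')+
  have "f * g = subst (tau_var i) (f * g) + xv i * ?h"
    unfolding subst_mult * by (simp add: algebra_simps)
  moreover have fg: "f \<in> poly_ring m" "g \<in> poly_ring m"
    using mult.hyps unfolding poly_ring_iff .
  have "?h \<in> poly_ring m"
  proof (cases "i \<in> {1..m}")
    case True
    then show ?thesis using h fg by simp
  next
    \<comment> \<open>If x_i is not a variable of \<open>poly_ring m\<close>, reduction modulo x_i
      changes nothing and h must be 0.\<close>
    case False
    have "subst (tau_var i) f = subst Var f"
      by (rule subst_cong_generated[OF mult.hyps(1)]) (use False in \<open>auto simp: tau_var_def\<close>)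
    then have "xv i * h = xv i * 0" using h(2) by (simp add: subst_Var_id)
    then have "h = 0" by (rule Var_mult_cancel)
    then show ?thesis using h fg by simp
  qed
  ultimately show ?case unfolding poly_ring_iff[symmetric] by blast
qed

context prime_char
begin

lemma N_inv_power_congruent:
  assumes "i \<in> {1..m}"
  shows "\<exists>h\<in>R. yv i ^ (p * k) = N_inv p i ^ k + xv i * h"
proof (induction k)
  case 0
  show ?case by (intro bexI[of _ 0]) simp_all
next
  case (Suc k)
  then obtain h where h: "h \<in> R" "yv i ^ (p * k) = N_inv p i ^ k + xv i * h" by blast
  let ?h = "yv i * xv i ^ (p - 2)"
  have "p - 1 = Suc (p - 2)" using p_ge_2 by simp
  then have y: "(yv i :: (coord \<times> nat, 'a) mpoly) ^ p = N_inv p i + xv i * ?h"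
    by (simp add: N_inv_def)
  have "(yv i :: (coord \<times> nat, 'a) mpoly) ^ (p * Suc k) = yv i ^ p * yv i ^ (p * k)"
    by (simp add: power_add)
  also have "\<dots> = N_inv p i * N_inv p i ^ k + xv i * (N_inv p i * h + ?h * (N_inv p i ^ k + xv i * h))"
    unfolding y h(2) by (simp add: algebra_simps)
  finally have "(yv i :: (coord \<times> nat, 'a) mpoly) ^ (p * Suc k) =
      N_inv p i ^ Suc k + xv i * (N_inv p i * h + ?h * (N_inv p i ^ k + xv i * h))"
    by (simp only: power_Suc)
  then show ?case using h assms by (intro bexI) (assumption, simp)
qed

text \<open>Modulo x_i, \<open>g\<close> is \<open>subst (rho_var i) g\<close> times y_i^(p k), and
  y_i^p is congruent to N_i. That p divides \<open>r i\<close> is what lets the P-invariant N_i^k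
  replace the whole power of y_i.\<close>

lemma rho_decomposition:
  assumes g: "g \<in> R" "mhom r g" and i: "i \<in> {1..m}" and ri: "r i = p * k" "k > 0"
  shows "\<exists>g'\<in>R. mhom (r(i := r i - 1)) g' \<and> g = N_inv p i ^ k * subst (rho_var i) g + xv i * g'"
proof -
  let ?q = "subst (rho_var i) g" and ?N = "N_inv p i ^ k"
  obtain h where h: "h \<in> R" "g = subst (tau_var i) g + xv i * h"
    using tau_congruent[OF g(1)] by blast
  obtain h' where h': "h' \<in> R" "yv i ^ (p * k) = ?N + xv i * h'"
    using N_inv_power_congruent[OF i] by blast
  let ?s = "r(i := r i - 1)"
  have eq: "r = (\<lambda>l. ((\<lambda>_. 0)(i := 1)) l + ?s l)"
    using ri p_ge_2 by (auto simp: fun_eq_iff)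
  define g' where "g' = multidegree_component ?s (?q * h' + h)"
  have "g' \<in> R" using h h' g i by (simp add: g'_def poly_ring_mc poly_ring_rho)
  have q: "g - ?N * ?q = xv i * (?q * h' + h)"
    using h(2) h'(2) tau_eq_rho[OF g(2), of i] ri by (simp add: algebra_simps)
  have r: "r = (\<lambda>l. k * ((\<lambda>_. 0)(i := p)) l + (r(i := 0)) l)"
    using ri by (auto simp: fun_eq_iff)
  have "mhom r (?N * ?q)"
    by (subst r, rule mhom_mult[OF mhom_power[OF mhom_N_inv] mhom_rho[OF g(2)]]) (use p_ge_2 in simp)
  then have "mhom r (xv i * (?q * h' + h))"
    using g(2) q mhom_diff by metis
  then have "mhom (\<lambda>l. ((\<lambda>_. 0)(i := 1)) l + ?s l) (xv i * (?q * h' + h))"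
    by (simp only: eq[symmetric])
  from mhom_factor[OF this mhom_Var] have "xv i * (?q * h' + h) = xv i * g'"
    by (simp only: g'_def)
  with q have "g - ?N * ?q = xv i * g'" by (rule trans)
  then have "g = ?N * ?q + xv i * g'" by (simp only: diff_eq_eq add.commute)
  moreover have "mhom ?s g'" by (simp only: g'_def mhom_mc)
  ultimately show ?thesis using \<open>g' \<in> R\<close> by blast
qed

lemma mhom_const:
  assumes "g \<in> R" "mhom r g" "\<forall>i\<in>{1..m}. r i = 0"
  shows "\<exists>c. g = Const c"
proof -
  have "t = 0" if t: "t \<in> Poly_Mapping.keys g" for t
  proof (rule poly_mapping_eqI)
    fix v :: "coord \<times> nat"
    obtain c i where v: "v = (c, i)" by (cases v)
    show "Poly_Mapping.lookup t v = Poly_Mapping.lookup 0 v"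
    proof (cases "i \<in> {1..m}")
      case True
      then have "multidegree t i = 0" using assms(2,3) t by (auto simp: mhom_def)
      then show ?thesis by (cases c) (auto simp: v multidegree_def)
    next
      case False
      then have "v \<notin> Poly_Mapping.keys t"
        using assms(1) t by (auto simp: poly_ring_def vars_def v)
      then show ?thesis by (simp add: in_keys_iff)
    qed
  qed
  then have "g = Const (Poly_Mapping.lookup g 0)"
    by (intro poly_mapping_eqI) (auto simp: Const_def lookup_single when_def in_keys_iff)
  then show ?thesis by blast
qed

lemma sum_degree_decrease:
  fixes r :: "nat \<Rightarrow> nat"
  assumes "i \<in> {1..m}" "n < r i"
  shows "(\<Sum>l\<in>{1..m}. (r(i := n)) l) < (\<Sum>l\<in>{1..m}. r l)"
  by (rule sum_strict_mono_ex1) (use assms in auto)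

text \<open>
  If \<open>p\<close> does not divide the degree in the \<open>i\<close>-th pair, Euler's identity reduces \<open>f = \<Delta>\<^sup>j g\<close> to its
  partial derivatives; otherwise one divides by a power of \<open>N\<^sub>i\<close>.
\<close>

theorem sylow_invariants_span:
  assumes "g \<in> R" "mhom r g" "j < p" "(Delta ^^ Suc j) g = 0"
  shows "(Delta ^^ j) g \<in> G j"
  using assms
\<comment> \<open>\<open>j\<close> must vary: in smaller degree the claim is used at the levels j +
  1 and j - 1 as well.\<close>
proof (induction "\<Sum>l\<in>{1..m}. r l" arbitrary: r j g rule: less_induct)
  case less
  let ?f = "(Delta ^^ j) g"
  have Delta_f: "Delta ?f = 0" using less.prems(4) by simp
  \<comment> \<open>j = p - 1 is set apart because the Euler case divides by j + 1.\<close>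
  consider (transfer) "j = p - 1" | (euler) i where "Suc j < p" "i \<in> {1..m}" "\<not> p dvd r i"
    | (norm) i where "i \<in> {1..m}" "p dvd r i" "r i > 0" | (const) "\<forall>i\<in>{1..m}. r i = 0"
    using less.prems(3) by (metis Suc_lessI diff_Suc_1 gr0I)
  then show ?case
  proof cases
    case transfer
    then show ?thesis using less.prems(1) by (simp only: sylow_span.tr)
  next
    case (euler i)
    let ?s = "r(i := r i - 1)"
    have ri: "r i > 0" using euler(3) by (cases "r i = 0") auto
    have dec: "(\<Sum>l\<in>{1..m}. ?s l) < (\<Sum>l\<in>{1..m}. r l)"
      using sum_degree_decrease[OF euler(2)] ri by simp
    define C where "C = partial (Y, i) g"
    define D where "D = partial (X, i) g"
    have CD: "C \<in> R" "D \<in> R" "mhom ?s C" "mhom ?s D"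
      using less.prems by (simp_all only: C_def D_def poly_ring_partial mhom_partial)
    define A where "A = (Delta ^^ j) C"
    define B where "B = (Delta ^^ j) D + of_nat j * sigma ((Delta ^^ (j - 1)) C)"
    have A: "partial (Y, i) ?f = A" and B: "partial (X, i) ?f = B"
      unfolding A_def B_def C_def D_def by (simp_all add: partial_Y_Dn partial_X_Dn)
    have DA: "Delta A = 0"
      using Delta_f partial_Y_Dn[of i 1 ?f] by (simp add: A)
    have "0 = partial (X, i) (Delta ?f)"
      unfolding Delta_f by simp
    also have "\<dots> = Delta B + sigma A"
      using partial_X_Dn[of i 1 ?f] by (simp add: A B)
    finally have DB: "Delta B = - A"
      using DA by (simp add: Delta_eq_0_iff eq_neg_iff_add_eq_0)
    have "Delta B = (Delta ^^ Suc j) D + of_nat j * A"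
    proof (cases j)
      case (Suc n)
      have "Delta (of_nat j * sigma ((Delta ^^ n) C)) = of_nat j * sigma A"
        using Dn_mult_invariant[OF sigma_of_nat[of j], of 1 "sigma ((Delta ^^ n) C)"]
        by (simp add: A_def Suc sigma_Delta)
      also have "sigma A = A" using DA by (simp add: Delta_eq_0_iff)
      finally show ?thesis by (simp add: B_def Suc Delta_add)
    qed (simp add: B_def)
    \<comment> \<open>Comparing the two expressions for Delta B exhibits A as an element of the
      image of Delta^(j+1), one level higher than f.\<close>
    with DB have "(Delta ^^ Suc j) D = - (of_nat (Suc j) * A)"
      by (simp add: algebra_simps eq_neg_iff_add_eq_0)
    moreover have ndvd: "\<not> p dvd Suc j" using euler(1) by (intro not_dvd_small) auto
    ultimately have A': "(Delta ^^ Suc j) (- (Const (1 / of_nat (Suc j)) * D)) = A"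
      unfolding Dn_uminus Dn_Const_mult
      by (simp only: mult_minus_right minus_minus mult.assoc[symmetric] of_nat_mpoly_inverse[OF ndvd] mult_1_left)
    have "A \<in> G (Suc j)"
      unfolding A'[symmetric]
    proof (rule less.hyps[OF dec _ _ euler(1)])
      show "- (Const (1 / of_nat (Suc j)) * D) \<in> R" "mhom ?s (- (Const (1 / of_nat (Suc j)) * D))"
        using CD by (simp, intro mhom_uminus mhom_Const_mult)
      show "(Delta ^^ Suc (Suc j)) (- (Const (1 / of_nat (Suc j)) * D)) = 0"
        unfolding funpow.simps(2)[of "Suc j"] o_apply A' DA ..
    qed
    from lift[OF this euler(1,2)] obtain b where b: "b \<in> R"
      "Delta ((Delta ^^ (j - 1)) b) = - A" "yv i * A + xv i * (Delta ^^ (j - 1)) b \<in> G j" by blast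
    \<comment> \<open>\<open>lift\<close> does not control degrees. Passing to a component restores
      homogeneity and keeps both conclusions, because Delta and \<open>sylow_span\<close> respect
      multidegrees.\<close>
    define b' where "b' = multidegree_component ?s b"
    have eq: "r = (\<lambda>l. ((\<lambda>_. 0)(i := 1)) l + ?s l)"
      using ri by (auto simp: fun_eq_iff)
    have As: "mhom ?s A" using CD(3) by (simp only: A_def mhom_Dn)
    have "multidegree_component (\<lambda>l. ((\<lambda>_. 0)(i := 1)) l + ?s l) (yv i * A + xv i * (Delta ^^ (j - 1)) b)
        = yv i * A + xv i * (Delta ^^ (j - 1)) b'"
      unfolding mc_add mc_mult_mhom[OF mhom_Var] mc_same[OF As] b'_def mc_Dn ..
    then have lifted: "yv i * A + xv i * (Delta ^^ (j - 1)) b' \<in> G j"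
      using G_mc[OF b(3), of r] by (simp only: eq[symmetric])
    have Db': "Delta ((Delta ^^ (j - 1)) b') = - A"
      using b(2) mc_same[OF mhom_uminus[OF As]] by (metis b'_def mc_Delta mc_Dn)
    \<comment> \<open>A preimage of B - Delta^(j-1) b' under Delta^(j-1), read off from the formula
      for B; for \<open>j = 0\<close> there is no Delta to split off, hence the case
      distinction.\<close>
    define e where "e = (if j = 0 then D else Delta D + of_nat j * sigma C) - b'"
    have e: "e \<in> R" "mhom ?s e"
    proof -
      have "Delta D \<in> R" "mhom ?s (Delta D)"
        using CD poly_ring_Dn[of D m 1] mhom_Dn[of ?s D 1] by (simp_all del: fun_upd_apply)
      moreover have "of_nat j * sigma C \<in> R" "mhom ?s (of_nat j * sigma C)"
        using CD unfolding Const_of_nat[symmetric]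
        by (blast intro: poly_ring_mult poly_ring_Const poly_ring_sigma mhom_Const_mult mhom_sigma)+
      moreover have "b' \<in> R" "mhom ?s b'"
        using b(1) by (simp_all only: b'_def poly_ring_mc mhom_mc)
      ultimately show "e \<in> R" "mhom ?s e"
        using CD unfolding e_def by (simp_all only: poly_ring_diff poly_ring_add mhom_diff mhom_add simp_thms split: if_split)
    qed
    have De: "(Delta ^^ (j - 1)) e = B - (Delta ^^ (j - 1)) b'"
    proof (cases j)
      case (Suc n)
      have "(Delta ^^ n) (of_nat j * sigma C) = of_nat j * sigma ((Delta ^^ n) C)"
        using Dn_mult_invariant[OF sigma_of_nat[of j], of n "sigma C"] by (simp add: Dn_sigma)
      moreover have "(Delta ^^ n) (Delta D) = (Delta ^^ j) D"
        using Dn_Dn[of n 1 D] Suc by simp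
      ultimately show ?thesis by (simp add: e_def B_def Suc Dn_diff Dn_add)
    qed (simp add: e_def B_def)
    \<comment> \<open>The induction hypothesis applies because Delta sends both B and Delta^(j-1) b'
      to -A.\<close>
    have "(Delta ^^ (j - 1)) e \<in> G (j - 1)"
    proof (rule less.hyps[OF dec e])
      show "(Delta ^^ Suc (j - 1)) e = 0"
        unfolding funpow.simps(2) o_apply De Delta_diff DB Db' by simp
    qed (use euler(1) in simp)
    from G_x_mult[OF this euler(2)] have "xv i * (Delta ^^ (j - 1)) e \<in> G j"
      by (rule G_antimono) simp
    from sylow_span.add[OF lifted this] have "xv i * B + yv i * A \<in> G j"
      unfolding De by (simp add: algebra_simps)
    then have "of_nat (r i) * ?f \<in> G j"
      using euler_identity[OF mhom_Dn[OF less.prems(2)], of i j] by (simp only: A B)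
    then have "Const (1 / of_nat (r i)) * (of_nat (r i) * ?f) \<in> G j" by (rule G_Const_mult)
    then show ?thesis
      by (simp only: mult.assoc[symmetric] of_nat_mpoly_inverse[OF euler(3)] mult_1_left)
  next
    case (norm i)
    then obtain k where k: "r i = p * k" by (auto elim: dvdE)
    with norm have "k > 0" by (cases k) auto
    obtain g' where g': "g' \<in> R" "mhom (r(i := r i - 1)) g'"
      "g = N_inv p i ^ k * subst (rho_var i) g + xv i * g'"
      using rho_decomposition[OF less.prems(1,2) norm(1) k \<open>k > 0\<close>] by blast
    let ?q = "subst (rho_var i) g"
    have q: "(Delta ^^ Suc j) ?q = 0"
      unfolding Dn_rho less.prems(4) by simp
    have inv: "sigma (N_inv p i ^ k) = (N_inv p i ^ k :: (coord \<times> nat, 'a) mpoly)"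
      by (simp add: sigma_power)
    have D: "(Delta ^^ n) g = N_inv p i ^ k * (Delta ^^ n) ?q + xv i * (Delta ^^ n) g'" for n
      by (subst g'(3)) (simp only: Dn_add Dn_mult_invariant[OF inv] Dn_mult_invariant[OF sigma_simps(4)])
    have "(Delta ^^ j) ?q \<in> G j"
      by (rule less.hyps[OF _ _ mhom_rho[OF less.prems(2)] less.prems(3) q])
        (use sum_degree_decrease[OF norm(1)] norm(3) less.prems(1) poly_ring_rho in blast)+
    then have 1: "N_inv p i ^ k * (Delta ^^ j) ?q \<in> G j"
      by (rule G_N_power_mult[OF _ norm(1)])
    \<comment> \<open>\<open>rho_var\<close> commutes with Delta, so Delta^(j+1) kills
      \<open>?q\<close> along with \<open>g\<close>; this leaves only the multiple of x_i, and x_i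
      cancels.\<close>
    have "xv i * (Delta ^^ Suc j) g' = xv i * 0"
      using D[of "Suc j"] unfolding q less.prems(4) by simp
    then have z: "(Delta ^^ Suc j) g' = 0" by (rule Var_mult_cancel)
    have "(Delta ^^ j) g' \<in> G j"
      by (rule less.hyps[OF sum_degree_decrease[OF norm(1)] g'(1,2) less.prems(3) z]) (use norm(3) in simp)
    from G_x_mult[OF this norm(1)] have "xv i * (Delta ^^ j) g' \<in> G j"
      by (rule G_antimono) simp
    with 1 show ?thesis unfolding D[of j] by (rule sylow_span.add)
  next
    case const
    obtain c where c: "g = Const c" using mhom_const[OF less.prems(1,2) const] by blast
    show ?thesis
    proof (cases j)
      case 0
      then show ?thesis using sylow_span.mon[of "[]" m "[]" "[]" 0 c p] by (simp add: c)
    next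
      case (Suc n)
      have "(Delta ^^ j) g = (Delta ^^ n) (Delta (Const c))"
        unfolding Suc c funpow_Suc_right o_apply ..
      then show ?thesis by (simp add: Delta_def)
    qed
  qed
qed

end

no_notation fps_nth (infixl "$" 75)

subsection \<open>The group action and the relative transfer\<close>

lemma act_simps: "act g (f + h) = act g f + act g h" "act g (f - h) = act g f - act g h"
    "act g (- f) = - act g f" "act g (f * h) = act g f * act g h" "act g (f ^ n) = act g f ^ n"
    "act g (Const c) = Const c" "act g 0 = 0" "act g (Var v) = act_var g v"
    "act g (sum F A) = (\<Sum>a\<in>A. act g (F a))" "act g (prod_list fs) = prod_list (map (act g) fs)"
  by (simp_all add: act_def subst_simps subst_prod_list)

lemma mhom_act_var: "mhom ((\<lambda>_. 0)(i := 1)) (act_var g (c, i))"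
  by (cases c) (simp_all only: act_var.simps, (intro mhom_diff mhom_Const_mult mhom_Var)+)

lemma mc_act: "multidegree_component l (act g f) = act g (multidegree_component l f)"
  unfolding act_def by (rule mc_subst[OF mhom_act_var])

lemma poly_ring_act:
  assumes "f \<in> poly_ring m"
  shows "act g f \<in> poly_ring m"
  unfolding act_def using assms
proof (rule poly_ring_subst)
  show "i \<in> {1..m} \<Longrightarrow> act_var g (c, i) \<in> poly_ring m" for c i
    by (cases c) simp_all
qed

lemma act_act: "act g (act h f) = act (g ** h) f"
  unfolding act_def subst_subst
proof (rule arg_cong[of _ _ "\<lambda>s. subst s f"], rule ext)
  fix v show "subst (act_var g) (act_var h v) = act_var (g ** h) v"
    by (cases v rule: sigma_var.cases)
      (simp_all add: subst_simps matrix_matrix_mult_def sum_2 Const_add Const_mult algebra_simps)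
qed

section \<open>Matrices and coset representatives\<close>

definition mat2 :: "'a::zero \<Rightarrow> 'a \<Rightarrow> 'a \<Rightarrow> 'a \<Rightarrow> 'a ^ 2 ^ 2" where
  "mat2 a b c d = vector [vector [a, b], vector [c, d]]"

lemma mat2_nth [simp]: "mat2 a b c d $ 1 $ 1 = a" "mat2 a b c d $ 1 $ 2 = b"
    "mat2 a b c d $ 2 $ 1 = c" "mat2 a b c d $ 2 $ 2 = d"
  by (simp_all add: mat2_def)

lemma mat2_eq_iff:
  fixes g h :: "'a ^ 2 ^ 2"
  shows "g = h \<longleftrightarrow> g $ 1 $ 1 = h $ 1 $ 1 \<and> g $ 1 $ 2 = h $ 1 $ 2 \<and>
    g $ 2 $ 1 = h $ 2 $ 1 \<and> g $ 2 $ 2 = h $ 2 $ 2"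
  by (auto simp: vec_eq_iff forall_2)

lemma mat2_mult_nth:
  fixes g h :: "'a::semiring_1 ^ 2 ^ 2"
  shows "(g ** h) $ i $ j = g $ i $ 1 * h $ 1 $ j + g $ i $ 2 * h $ 2 $ j"
  by (simp add: matrix_matrix_mult_def sum_2)

lemma SL2p_iff: "g \<in> SL2p \<longleftrightarrow> g $ 1 $ 1 \<in> \<int> \<and> g $ 1 $ 2 \<in> \<int> \<and> g $ 2 $ 1 \<in> \<int> \<and> g $ 2 $ 2 \<in> \<int> \<and>
    g $ 1 $ 1 * g $ 2 $ 2 - g $ 1 $ 2 * g $ 2 $ 1 = 1"
  by (auto simp: SL2p_def forall_2 det_2)

lemma SL2p_mult: "g \<in> SL2p \<Longrightarrow> h \<in> SL2p \<Longrightarrow> g ** h \<in> SL2p"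
  by (simp add: SL2p_def det_mul mat2_mult_nth)

definition unipotent :: "'a::field \<Rightarrow> 'a ^ 2 ^ 2" where
  "unipotent k = mat2 1 k 0 1"

text \<open>The value at \<open>(a, c) \<noteq> 0\<close> has determinant \<open>1\<close> and first column \<open>(a, c)\<close>; the one at \<open>(0, 0)\<close> is junk.\<close>

definition col_rep :: "'a::field \<times> 'a \<Rightarrow> 'a ^ 2 ^ 2" where
  "col_rep v = (case v of (a, c) \<Rightarrow> if a \<noteq> 0 then mat2 a 0 c (1 / a) else mat2 0 (- 1 / c) c 0)"

definition nonzero_cols :: "('a::field \<times> 'a) set" where
  "nonzero_cols = \<int> \<times> \<int> - {(0, 0)}"

text \<open>
  The cosets of the Sylow subgroup are determined by the first column of their elements.
\<close>

definition rel_transfer :: "(coord \<times> nat, 'a::field) mpoly \<Rightarrow> (coord \<times> nat, 'a) mpoly" where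
  "rel_transfer f = (\<Sum>v\<in>nonzero_cols. act (col_rep v) f)"

lemma col_rep_factorization:
  fixes g :: "'a::field ^ 2 ^ 2"
  assumes "det g = 1"
  shows "col_rep (g $ 1 $ 1, g $ 2 $ 1) **
    unipotent (if g $ 1 $ 1 \<noteq> 0 then g $ 1 $ 2 / g $ 1 $ 1 else g $ 2 $ 2 / g $ 2 $ 1) = g"
proof (cases "g $ 1 $ 1 = 0")
  case True
  then have "g $ 1 $ 2 * g $ 2 $ 1 = - 1" using assms by (simp add: det_2 minus_equation_iff)
  moreover from this have "g $ 2 $ 1 \<noteq> 0" by auto
  ultimately show ?thesis
    using True by (simp add: mat2_eq_iff mat2_mult_nth col_rep_def unipotent_def field_simps)
next
  case False
  then have "g $ 2 $ 2 = (1 + g $ 1 $ 2 * g $ 2 $ 1) / g $ 1 $ 1"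
    using assms by (simp add: det_2 field_simps)
  with False show ?thesis
    by (simp add: mat2_eq_iff mat2_mult_nth col_rep_def unipotent_def field_simps)
qed

text \<open>A group element acts on coordinates through its inverse, which is why sigma is
  \<open>unipotent (- 1)\<close> and not \<open>unipotent 1\<close>.\<close>

lemma act_unipotent_funpow:
  fixes f :: "(coord \<times> nat, 'a::field) mpoly"
  shows "(sigma ^^ n) f = act (unipotent (- of_nat n)) f"
proof (induction n)
  case 0
  have "act_var (unipotent (0 :: 'a)) = Var"
  proof
    fix v show "act_var (unipotent (0 :: 'a)) v = Var v"
      by (cases v rule: sigma_var.cases) (simp_all add: unipotent_def)
  qed
  then show ?case by (simp add: act_def subst_Var_id)
next
  case (Suc n)
  have s: "(sigma :: (coord \<times> nat, 'a) mpoly \<Rightarrow> _) = act (unipotent (- 1))"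
    unfolding sigma_def act_def
  proof (rule arg_cong[of _ _ subst], rule ext)
    fix v show "sigma_var v = act_var (unipotent (- 1 :: 'a)) v"
      by (cases v rule: sigma_var.cases) (simp_all add: unipotent_def Const_uminus)
  qed
  have "(sigma ^^ Suc n) f = act (unipotent (- 1) ** unipotent (- of_nat n)) f"
    unfolding funpow.simps o_apply Suc fun_cong[OF s] act_act ..
  moreover have "unipotent (- 1) ** unipotent (- of_nat n) = unipotent (- of_nat (Suc n) :: 'a)"
    by (simp add: mat2_eq_iff mat2_mult_nth unipotent_def)
  ultimately show ?case by (simp only:)
qed

context prime_char
begin

section \<open>The prime field and the transitivity of the transfer\<close>

lemma frobenius_field: "(a + b :: 'a) ^ p = a ^ p + b ^ p"
  by (rule freshmans_dream) (simp_all add: char_p prime_p)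

lemma Ints_eq: "(\<int> :: 'a set) = of_nat ` {..<p}"
proof
  show "\<int> \<subseteq> (of_nat ` {..<p} :: 'a set)"
  proof
    fix a :: 'a assume "a \<in> \<int>"
    then obtain z where a: "a = of_int z" by (elim Ints_cases)
    have "int (nat (z mod int p)) = z - int p * (z div int p)"
      using p_ge_2 by (simp add: minus_mult_div_eq_mod)
    then have "of_nat (nat (z mod int p)) = (of_int (z - int p * (z div int p)) :: 'a)"
      by (metis of_int_of_nat_eq)
    also have "\<dots> = a - of_nat p * of_int (z div int p)"
      by (simp add: a)
    also have "(of_nat p :: 'a) = 0" by (simp add: of_nat_eq_0)
    finally have "a = of_nat (nat (z mod int p))" by simp
    moreover have "nat (z mod int p) < p" using p_ge_2 by (simp add: nat_less_iff)
    ultimately show "a \<in> of_nat ` {..<p}" by blast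
  qed
qed auto

lemma inj_of_nat: "inj_on (of_nat :: nat \<Rightarrow> 'a) {..<p}"
proof (rule linorder_inj_onI)
  fix x y assume *: "x < y" "y \<in> {..<p}"
  then have "(of_nat (y - x) :: 'a) \<noteq> 0"
    unfolding of_nat_eq_0 by (intro not_dvd_small) auto
  with * show "(of_nat x :: 'a) \<noteq> of_nat y" by (simp add: of_nat_diff)
qed auto

lemma card_Ints: "card (\<int> :: 'a set) = p"
  unfolding Ints_eq by (simp add: card_image inj_of_nat)

lemma Ints_power_p: "(a :: 'a) \<in> \<int> \<Longrightarrow> a ^ p = a"
proof -
  have "(of_nat n :: 'a) ^ p = of_nat n" for n
    by (induction n) (use p_ge_2 in \<open>simp_all add: frobenius_field\<close>)
  then show "a \<in> \<int> \<Longrightarrow> a ^ p = a" unfolding Ints_eq by auto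
qed

lemma Ints_power_p1:
  assumes "(a :: 'a) \<in> \<int>" "a \<noteq> 0"
  shows "a ^ (p - 1) = 1"
proof -
  have "p = Suc (p - 1)" using p_ge_2 by simp
  then have "a * a ^ (p - 1) = a * 1" using Ints_power_p[OF assms(1)] by (metis mult.right_neutral power_Suc)
  with assms(2) show ?thesis by simp
qed

lemma Ints_inverse:
  assumes "(a :: 'a) \<in> \<int>"
  shows "1 / a \<in> \<int>"
proof (cases "a = 0")
  case False
  have "p - 1 = Suc (p - 2)" using p_ge_2 by simp
  then have "a * a ^ (p - 2) = 1" using Ints_power_p1[OF assms False] by (metis power_Suc)
  then have "1 / a = a ^ (p - 2)" using False by (simp add: field_simps)
  then show ?thesis using assms by simp
qed simp

lemma Ints_divide: "(a :: 'a) \<in> \<int> \<Longrightarrow> b \<in> \<int> \<Longrightarrow> a / b \<in> \<int>"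
  using Ints_mult[OF _ Ints_inverse, of a b] by simp

lemma card_nonzero_cols: "(of_nat (card (nonzero_cols :: ('a \<times> 'a) set)) :: 'a) = - 1"
proof -
  have "card (nonzero_cols :: ('a \<times> 'a) set) = p * p - 1"
    by (simp add: nonzero_cols_def card_Diff_singleton card_cartesian_product card_Ints)
  moreover have "(of_nat (p * p - 1) :: 'a) = of_nat p * of_nat p - 1"
    using p_ge_2 by (subst of_nat_diff) auto
  ultimately show ?thesis by (simp add: of_nat_eq_0)
qed

lemma col_rep_SL2p: "v \<in> nonzero_cols \<Longrightarrow> (col_rep v :: 'a ^ 2 ^ 2) \<in> SL2p"
  by (cases v, cases "fst v = 0")
    (auto simp: SL2p_iff col_rep_def nonzero_cols_def Ints_inverse Ints_divide)

lemma unipotent_SL2p: "k \<in> \<int> \<Longrightarrow> (unipotent k :: 'a ^ 2 ^ 2) \<in> SL2p"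
  by (auto simp: SL2p_iff unipotent_def)

lemma first_col_nonzero: "(g :: 'a ^ 2 ^ 2) \<in> SL2p \<Longrightarrow> (g $ 1 $ 1, g $ 2 $ 1) \<in> nonzero_cols"
  by (auto simp: SL2p_iff nonzero_cols_def)

lemma act_unipotent_invariant:
  fixes f :: "(coord \<times> nat, 'a) mpoly"
  assumes "sigma f = f" "k \<in> \<int>"
  shows "act (unipotent k) f = f"
proof -
  have "- k \<in> of_nat ` {..<p}" using assms(2) by (simp flip: Ints_eq)
  then obtain n where "- k = of_nat n" by auto
  then have "k = - of_nat n" by (metis minus_minus)
  moreover have "(sigma ^^ n) f = f" by (induction n) (simp_all add: assms(1))
  ultimately show ?thesis by (simp add: act_unipotent_funpow)
qed

text \<open>On a P-invariant, \<open>g\<close> acts only through the coset g P, and right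
  multiplication by P leaves the first column unchanged.\<close>

lemma act_first_col:
  fixes f :: "(coord \<times> nat, 'a) mpoly"
  assumes "sigma f = f" "g \<in> SL2p"
  shows "act g f = act (col_rep (g $ 1 $ 1, g $ 2 $ 1)) f"
proof -
  have "det g = 1" using assms(2) by (simp add: SL2p_def)
  from col_rep_factorization[OF this] obtain k where
    "k = (if g $ 1 $ 1 \<noteq> 0 then g $ 1 $ 2 / g $ 1 $ 1 else g $ 2 $ 2 / g $ 2 $ 1)"
    "col_rep (g $ 1 $ 1, g $ 2 $ 1) ** unipotent k = g" by blast
  moreover from this have "k \<in> \<int>" using assms(2) by (simp add: SL2p_iff Ints_divide)
  ultimately show ?thesis using act_unipotent_invariant[OF assms(1)] by (metis act_act)
qed

lemma minus_one_power_p1: "(- 1 :: 'a) ^ (p - 1) = 1"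
  by (rule Ints_power_p1) simp_all

text \<open>By Pascal's rule, and since p divides the binomial coefficients of p strictly between
  the ends, consecutive coefficients of p - 1 are negatives of each other.\<close>

lemma of_nat_choose_p1: "k \<le> p - 1 \<Longrightarrow> (of_nat ((p - 1) choose k) :: 'a) = (- 1) ^ k"
proof (induction k)
  case (Suc k)
  have "p = Suc (p - 1)" using p_ge_2 by simp
  then have "p choose Suc k = ((p - 1) choose k) + ((p - 1) choose Suc k)"
    by (metis binomial_Suc_Suc)
  moreover have "p dvd (p choose Suc k)"
    using Suc.prems p_ge_2 prime_p by (intro dvd_choose_prime) auto
  ultimately have "(of_nat ((p - 1) choose k) :: 'a) + of_nat ((p - 1) choose Suc k) = 0"
    by (metis of_nat_add of_nat_eq_0)
  with Suc show ?case by (simp add: add_eq_0_iff)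
qed simp

lemma Dn_binomial: "(Delta ^^ n) f =
    (\<Sum>k\<le>n. Const ((- 1) ^ (n - k) * of_nat (n choose k) :: 'a) * (sigma ^^ k) f)"
proof (induction n)
  case (Suc n)
  let ?c = "\<lambda>n k. Const ((- 1) ^ (n - k) * of_nat (n choose k) :: 'a)"
  have sigma_sum: "sigma (\<Sum>k\<le>n. ?c n k * (sigma ^^ k) f) = (\<Sum>k\<le>n. ?c n k * (sigma ^^ Suc k) f)"
    by (simp add: sigma_def subst_sum subst_mult)
  \<comment> \<open>Pascal's rule with signs; the guard stands for the absent index n + 1 in the sum
    for n.\<close>
  have shift: "?c (Suc n) (Suc k) = ?c n k - (if Suc k \<le> n then ?c n (Suc k) else 0)" if "k \<le> n" for k
  proof (cases "Suc k \<le> n")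
    case True
    then have "n - k = Suc (n - Suc k)" by simp
    then show ?thesis using True by (simp add: Const_diff[symmetric] Const_uminus[symmetric] algebra_simps)
  next
    case False
    with that have "k = n" by simp
    then show ?thesis by simp
  qed
  have "(Delta ^^ Suc n) f = sigma ((Delta ^^ n) f) - (Delta ^^ n) f"
    by (simp add: Delta_def)
  also have "\<dots> = (\<Sum>k\<le>n. ?c n k * (sigma ^^ Suc k) f) - (\<Sum>k\<le>n. ?c n k * (sigma ^^ k) f)"
    unfolding Suc sigma_sum ..
  also have "(\<Sum>k\<le>n. ?c n k * (sigma ^^ k) f) =
      ?c n 0 * f + (\<Sum>k\<le>n. (if Suc k \<le> n then ?c n (Suc k) else 0) * (sigma ^^ Suc k) f)"
  proof -
    have "(\<Sum>k\<le>n. ?c n k * (sigma ^^ k) f) =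
        (\<Sum>k\<le>Suc n. (if k \<le> n then ?c n k else 0) * (sigma ^^ k) f)"
      by (simp add: sum.atMost_Suc)
    also have "\<dots> = ?c n 0 * f + (\<Sum>k\<le>n. (if Suc k \<le> n then ?c n (Suc k) else 0) * (sigma ^^ Suc k) f)"
      by (subst sum.atMost_Suc_shift) simp
    finally show ?thesis .
  qed
  also have "(\<Sum>k\<le>n. ?c n k * (sigma ^^ Suc k) f) - \<dots> = - ?c n 0 * f +
      (\<Sum>k\<le>n. (?c n k - (if Suc k \<le> n then ?c n (Suc k) else 0)) * (sigma ^^ Suc k) f)"
    by (simp add: sum_subtractf left_diff_distrib)
  also have "(\<Sum>k\<le>n. (?c n k - (if Suc k \<le> n then ?c n (Suc k) else 0)) * (sigma ^^ Suc k) f) =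
      (\<Sum>k\<le>n. ?c (Suc n) (Suc k) * (sigma ^^ Suc k) f)"
    by (rule sum.cong) (simp_all only: shift atMost_iff)
  also have "- ?c n 0 * f = ?c (Suc n) 0 * (sigma ^^ 0) f"
    by (simp add: Const_uminus)
  also have "?c (Suc n) 0 * (sigma ^^ 0) f + (\<Sum>k\<le>n. ?c (Suc n) (Suc k) * (sigma ^^ Suc k) f) =
      (\<Sum>k\<le>Suc n. ?c (Suc n) k * (sigma ^^ k) f)"
    by (rule sum.atMost_Suc_shift[symmetric])
  finally show ?case .
qed simp

text \<open>In characteristic p all signed binomial coefficients of (sigma - 1)^(p-1) equal
  (-1)^(p-1) = 1, so this power is the sum of the sigma^n with n < p.\<close>

lemma sylow_transfer: "(\<Sum>k\<in>\<int>. act (unipotent (k :: 'a)) f) = (Delta ^^ (p - 1)) f"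
proof -
  have "(\<Sum>k\<in>\<int>. act (unipotent (k :: 'a)) f) = (\<Sum>k\<in>\<int>. act (unipotent (- k :: 'a)) f)"
    by (rule sum.reindex_bij_witness[of _ uminus uminus]) auto
  also have "\<dots> = (\<Sum>n<p. act (unipotent (- of_nat n)) f)"
    unfolding Ints_eq by (rule sum.reindex[OF inj_of_nat, unfolded o_def])
  also have "\<dots> = (\<Sum>n\<le>p - 1. (sigma ^^ n) f)"
  proof (rule sum.cong)
    show "{..<p} = {..p - 1}" using p_ge_2 by auto
  qed (simp add: act_unipotent_funpow)
  also have "\<dots> = (\<Sum>n\<le>p - 1. Const ((- 1) ^ (p - 1 - n) * of_nat (p - 1 choose n) :: 'a) * (sigma ^^ n) f)"
  proof (rule sum.cong)
    fix n assume "n \<in> {..p - 1}"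
    then have n: "n \<le> p - 1" by simp
    have "(- 1 :: 'a) ^ (p - 1 - n) * of_nat (p - 1 choose n) = 1"
      unfolding of_nat_choose_p1[OF n] power_add[symmetric] le_add_diff_inverse2[OF n]
      by (rule minus_one_power_p1)
    then show "(sigma ^^ n) f = Const ((- 1) ^ (p - 1 - n) * of_nat (p - 1 choose n) :: 'a) * (sigma ^^ n) f"
      by simp
  qed simp
  finally show ?thesis by (simp only: Dn_binomial)
qed

text \<open>Transitivity of the transfer: each g is in a unique way the representative of its first
  column times a unipotent matrix, and the inner sum over the latter is Delta^(p-1).\<close>

theorem transfer_eq_rel_transfer:
  fixes f :: "(coord \<times> nat, 'a) mpoly"
  shows "transfer f = rel_transfer ((Delta ^^ (p - 1)) f)"
proof -
  let ?k = "\<lambda>g :: 'a ^ 2 ^ 2. if g $ 1 $ 1 \<noteq> 0 then g $ 1 $ 2 / g $ 1 $ 1 else g $ 2 $ 2 / g $ 2 $ 1"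
  have "rel_transfer ((Delta ^^ (p - 1)) f) =
      (\<Sum>v\<in>nonzero_cols. \<Sum>k\<in>\<int>. act (col_rep v ** unipotent k) f)"
    unfolding rel_transfer_def sylow_transfer[symmetric] act_simps act_act ..
  also have "\<dots> = (\<Sum>w\<in>nonzero_cols \<times> \<int>. act (col_rep (fst w) ** unipotent (snd w)) f)"
    by (simp add: sum.cartesian_product case_prod_unfold)
  also have "\<dots> = (\<Sum>g\<in>SL2p. act g f)"
  proof (rule sum.reindex_bij_witness[of _ "\<lambda>g. ((g $ 1 $ 1, g $ 2 $ 1), ?k g)"
        "\<lambda>w. col_rep (fst w) ** unipotent (snd w)"])
    fix w :: "('a \<times> 'a) \<times> 'a" assume w: "w \<in> nonzero_cols \<times> \<int>"
    let ?g = "col_rep (fst w) ** unipotent (snd w)"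
    show "?g \<in> SL2p" using w by (auto intro!: SL2p_mult col_rep_SL2p unipotent_SL2p)
    show "((?g $ 1 $ 1, ?g $ 2 $ 1), ?k ?g) = w"
      using w by (cases w, cases "fst (fst w) = 0")
        (auto simp: mat2_mult_nth unipotent_def col_rep_def nonzero_cols_def)
  next
    fix g :: "'a ^ 2 ^ 2" assume g: "g \<in> SL2p"
    then have "det g = 1" by (simp add: SL2p_def)
    from col_rep_factorization[OF this]
    show "col_rep (fst ((g $ 1 $ 1, g $ 2 $ 1), ?k g)) ** unipotent (snd ((g $ 1 $ 1, g $ 2 $ 1), ?k g)) = g"
      by simp
    show "((g $ 1 $ 1, g $ 2 $ 1), ?k g) \<in> nonzero_cols \<times> \<int>"
      using first_col_nonzero[OF g] g by (auto simp: SL2p_iff Ints_divide)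
  qed simp
  finally show ?thesis by (simp add: transfer_def)
qed

section \<open>Linearity of the relative transfer and torus weights\<close>

lemma rel_transfer_add: "rel_transfer (f + g) = rel_transfer f + rel_transfer g"
  and rel_transfer_diff: "rel_transfer (f - g) = rel_transfer f - rel_transfer g"
  and rel_transfer_0 [simp]: "rel_transfer 0 = 0"
  by (simp_all add: rel_transfer_def act_simps sum.distrib sum_subtractf)

lemma rel_transfer_sum: "rel_transfer (sum F A) = (\<Sum>a\<in>A. rel_transfer (F a))"
  by (induction A rule: infinite_finite_induct) (simp_all add: rel_transfer_add)

lemma rel_transfer_mult:
  fixes f :: "(coord \<times> nat, 'a) mpoly"
  assumes "\<And>g. g \<in> SL2p \<Longrightarrow> act g a = a"
  shows "rel_transfer (a * f) = a * rel_transfer f"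
  by (simp add: rel_transfer_def act_simps assms col_rep_SL2p sum_distrib_left)

lemma rel_transfer_invariant:
  fixes f :: "(coord \<times> nat, 'a) mpoly"
  assumes "\<And>g. g \<in> SL2p \<Longrightarrow> act g f = f"
  shows "rel_transfer f = - f"
proof -
  have "rel_transfer f = of_nat (card (nonzero_cols :: ('a \<times> 'a) set)) * f"
    by (simp add: rel_transfer_def assms col_rep_SL2p)
  also have "(of_nat (card (nonzero_cols :: ('a \<times> 'a) set)) :: (coord \<times> nat, 'a) mpoly) = Const (- 1)"
    using card_nonzero_cols by (metis Const_of_nat)
  finally show ?thesis by (simp add: Const_uminus)
qed

text \<open>The torus normalizes the Sylow subgroup, so a nontrivial weight kills the relative transfer.\<close>

lemma rel_transfer_weight:
  fixes f :: "(coord \<times> nat, 'a) mpoly"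
  assumes f: "sigma f = f" and a: "a \<in> \<int>" "a \<noteq> 0"
    and weight: "act (mat2 a 0 0 (1 / a)) f = Const c * f" "c \<noteq> 1"
  shows "rel_transfer f = 0"
proof -
  let ?t = "mat2 a 0 0 (1 / a)"
  have t: "?t \<in> SL2p" using a by (simp add: SL2p_iff Ints_inverse)
  have "Const c * rel_transfer f = rel_transfer (Const c * f)"
    by (simp add: rel_transfer_mult act_simps)
  also have "\<dots> = (\<Sum>v\<in>nonzero_cols. act (col_rep v ** ?t) f)"
    by (simp add: rel_transfer_def flip: weight(1) act_act)
  \<comment> \<open>The torus element, multiplied from the right, scales the first column by a, and
    a P-invariant sees only that column. Scaling permutes the nonzero columns, which returns the
    original sum.\<close>
  also have "\<dots> = (\<Sum>v\<in>nonzero_cols. act (col_rep (a * fst v, a * snd v)) f)"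
  proof (rule sum.cong)
    fix v :: "'a \<times> 'a" assume v: "v \<in> nonzero_cols"
    have "(col_rep v ** ?t) $ 1 $ 1 = a * fst v" "(col_rep v ** ?t) $ 2 $ 1 = a * snd v"
      by (auto simp: mat2_mult_nth col_rep_def split: prod.split)
    then show "act (col_rep v ** ?t) f = act (col_rep (a * fst v, a * snd v)) f"
      using act_first_col[OF f SL2p_mult[OF col_rep_SL2p[OF v] t]] by simp
  qed simp
  also have "\<dots> = rel_transfer f"
    unfolding rel_transfer_def
    by (rule sum.reindex_bij_witness[of _ "\<lambda>v. (fst v / a, snd v / a)" "\<lambda>v. (a * fst v, a * snd v)"])
      (use a in \<open>auto simp: nonzero_cols_def Ints_divide\<close>)
  finally have "Const (c - 1) * rel_transfer f = 0"
    by (simp add: Const_diff left_diff_distrib)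
  then have "Const (1 / (c - 1)) * (Const (c - 1) * rel_transfer f) = 0" by simp
  then show ?thesis
    using weight(2) by (simp add: mult.assoc[symmetric] Const_mult[symmetric])
qed

text \<open>X^n - 1 has at most n roots, fewer than the p - 1 units of F_p.\<close>

lemma exists_nontrivial_power:
  assumes "0 < n" "n < p - 1"
  shows "\<exists>a::'a. a \<in> \<int> \<and> a \<noteq> 0 \<and> a ^ n \<noteq> 1"
proof (rule ccontr)
  assume "\<not> ?thesis"
  then have "\<int> - {0} \<subseteq> {a::'a. poly (monom 1 n - 1) a = 0}"
    by (auto simp: poly_monom)
  moreover have nz: "monom 1 n - 1 \<noteq> (0 :: 'a poly)"
    using assms(1) by (metis degree_1 degree_monom_eq eq_iff_diff_eq_0 less_numeral_extra(3) one_neq_zero)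
  ultimately have "card (\<int> - {0 :: 'a}) \<le> card {a::'a. poly (monom 1 n - 1) a = 0}"
    by (intro card_mono poly_roots_finite) auto
  also have "\<dots> \<le> degree (monom 1 n - 1 :: 'a poly)"
    by (rule card_poly_roots_bound[OF nz])
  also have "\<dots> \<le> n"
    by (rule degree_diff_le) (simp_all add: degree_monom_le)
  finally show False using assms by (simp add: card_Diff_singleton card_Ints)
qed

lemma rel_transfer_short_x:
  assumes "0 < length xs" "length xs < p - 1"
  shows "rel_transfer (x_prod xs) = (0 :: (coord \<times> nat, 'a) mpoly)"
proof -
  obtain a :: 'a where a: "a \<in> \<int>" "a \<noteq> 0" "a ^ length xs \<noteq> 1"
    using exists_nontrivial_power[OF assms] by blast
  have "act (mat2 a 0 0 (1 / a)) (x_prod xs) = Const (a ^ length xs) * x_prod xs"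
    by (induction xs) (simp_all add: act_simps act_def subst_mult Const_mult mult_ac)
  then show ?thesis using rel_transfer_weight[OF _ a(1,2) _ a(3)] by simp
qed

lemma rel_transfer_short_N:
  assumes "0 < length js" "length js < p - 1"
  shows "rel_transfer (N_prod p js) = (0 :: (coord \<times> nat, 'a) mpoly)"
proof -
  obtain b :: 'a where b: "b \<in> \<int>" "b \<noteq> 0" "b ^ length js \<noteq> 1"
    using exists_nontrivial_power[OF assms] by blast
  \<comment> \<open>As a^(p-1) = 1 and b^p = b, both terms of N_j scale like y_j, that is by b, the
    inverse of the torus parameter.\<close>
  define a where "a = 1 / b"
  have a: "a \<in> \<int>" "a \<noteq> 0" "1 / a = b" using b by (simp_all add: a_def Ints_inverse)
  have "act (mat2 a 0 0 b) (N_inv p j) = Const b * (N_inv p j :: (coord \<times> nat, 'a) mpoly)" for j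
    using Ints_power_p[OF b(1)] Ints_power_p1[OF a(1,2)]
    by (simp add: N_inv_def act_simps power_mult_distrib right_diff_distrib mult_ac flip: Const_power)
  then have "act (mat2 a 0 0 b) (N_prod p js) = Const (b ^ length js) * (N_prod p js :: (coord \<times> nat, 'a) mpoly)"
    by (induction js) (simp_all add: act_simps act_def subst_mult Const_mult mult_ac)
  then show ?thesis using rel_transfer_weight[OF _ a(1,2) _ b(3)] by (simp add: a(3))
qed

end

subsection \<open>Dickson components modulo the \<open>u\<^sub>i\<^sub>j\<close>\<close>

text \<open>The ideal generated by the u_ab within the P-invariants and not within all polynomials:
  the cofactor must be P-invariant for the induction on degree to apply to its relative
  transfer.\<close>

inductive_set u_ideal :: "nat \<Rightarrow> (coord \<times> nat, 'a::field) mpoly set" for m :: nat where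
  zero: "0 \<in> u_ideal m"
| gen: "a \<in> {1..m} \<Longrightarrow> b \<in> {1..m} \<Longrightarrow> s \<in> poly_ring m \<Longrightarrow> sigma s = s \<Longrightarrow> u_inv a b * s \<in> u_ideal m"
| add: "f \<in> u_ideal m \<Longrightarrow> g \<in> u_ideal m \<Longrightarrow> f + g \<in> u_ideal m"

lemma u_ideal_poly_ring: "f \<in> u_ideal m \<Longrightarrow> f \<in> poly_ring m"
  by (induction rule: u_ideal.induct) simp_all

lemma u_ideal_sigma: "f \<in> u_ideal m \<Longrightarrow> sigma f = f"
  by (induction rule: u_ideal.induct) (simp_all add: sigma_mult sigma_add)

lemma u_ideal_mult:
  assumes "f \<in> u_ideal m" "s \<in> poly_ring m" "sigma s = s"
  shows "f * s \<in> u_ideal m"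
  using assms(1)
proof (induction rule: u_ideal.induct)
  case (gen a b t)
  then have "u_inv a b * (t * s) \<in> u_ideal m"
    by (intro u_ideal.gen) (simp_all add: assms sigma_mult)
  then show ?case by (simp add: mult.assoc)
qed (simp_all add: distrib_right u_ideal.intros)

lemma u_ideal_sum: "(\<And>a. a \<in> A \<Longrightarrow> F a \<in> u_ideal m) \<Longrightarrow> sum F A \<in> u_ideal m"
  by (induction A rule: infinite_finite_induct) (auto intro: u_ideal.intros)

lemma u_ideal_mc: "f \<in> u_ideal m \<Longrightarrow> multidegree_component l f \<in> u_ideal m"
proof (induction rule: u_ideal.induct)
  case (gen a b s)
  have inv: "sigma (multidegree_component t s) = multidegree_component t s" for t
    using gen(4) mc_Delta[of t s] by (simp flip: Delta_eq_0_iff)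
  show ?case
    by (rule mc_mult_mhom_cases[OF mhom_u_inv, of l a b s])
      (simp_all only: u_ideal.zero u_ideal.gen[OF gen(1,2) poly_ring_mc[OF gen(3)] inv])
qed (simp_all add: mc_add u_ideal.intros)

lemma u_ideal_power_diff:
  assumes "a \<in> poly_ring m" "sigma a = a" "z \<in> u_ideal m"
  shows "(a + z) ^ n - a ^ n \<in> u_ideal m"
proof (induction n)
  case (Suc n)
  have "((a + z) ^ n - a ^ n) * (a + z) + z * a ^ n \<in> u_ideal m"
    by (intro u_ideal.add u_ideal_mult Suc assms)
      (simp_all add: assms u_ideal_poly_ring u_ideal_sigma[OF assms(3)] sigma_add sigma_power)
  then show ?case by (simp add: algebra_simps)
qed (simp add: u_ideal.zero)

lemma sigma_sum: "sigma (sum F A) = (\<Sum>a\<in>A. sigma (F a))"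
  by (simp add: sigma_def subst_sum)

section \<open>Multidegree components of powers of sums\<close>

lemma sum_power_lists:
  fixes a :: "'b \<Rightarrow> 'c::comm_semiring_1"
  assumes "finite I"
  shows "(\<Sum>i\<in>I. a i) ^ n = (\<Sum>l\<in>{l. set l \<subseteq> I \<and> length l = n}. prod_list (map a l))"
proof (induction n)
  case 0
  have "{l. set l \<subseteq> I \<and> length l = 0} = {[]}" by auto
  then show ?case by simp
next
  case (Suc n)
  let ?S = "{l. set l \<subseteq> I \<and> length l = n}"
  have "(\<Sum>l\<in>{l. set l \<subseteq> I \<and> length l = Suc n}. prod_list (map a l)) =
      (\<Sum>w\<in>?S \<times> I. prod_list (map a (snd w # fst w)))"
    unfolding lists_length_Suc_eq
    by (subst sum.reindex) (auto simp: inj_on_def case_prod_unfold)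
  also have "\<dots> = (\<Sum>l\<in>?S. \<Sum>i\<in>I. a i * prod_list (map a l))"
    by (simp add: sum.cartesian_product case_prod_unfold)
  also have "\<dots> = (\<Sum>i\<in>I. a i) * (\<Sum>l\<in>?S. prod_list (map a l))"
    by (simp add: sum_distrib_left sum_distrib_right)
  finally show ?case using Suc by simp
qed

lemma mhom_prod_list_multiset:
  assumes "\<And>i. mhom ((\<lambda>_. 0)(i := p)) (a i)"
  shows "mhom (\<lambda>q. p * count (mset l) q) (prod_list (map a l))"
proof (induction l)
  case Nil
  then show ?case using mhom_1 by simp
next
  case (Cons i l)
  have "(\<lambda>q. p * count (mset (i # l)) q) = (\<lambda>q. ((\<lambda>_. 0)(i := p)) q + p * count (mset l) q)"
    by auto
  then show ?case using mhom_mult[OF assms Cons] by (simp only: list.map prod_list.Cons)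
qed

lemma prod_list_map_mset_eq:
  fixes a :: "'b \<Rightarrow> 'c::comm_monoid_mult"
  assumes "mset l = mset k"
  shows "prod_list (map a l) = prod_list (map a k)"
proof -
  have "prod_mset (image_mset a (mset l)) = prod_mset (image_mset a (mset k))"
    using assms by simp
  then show ?thesis by (metis mset_map prod_mset_prod_list)
qed

text \<open>When the power is expanded over lists, the multidegree determines the multiset of
  indices. The surviving terms are the rearrangements of \<open>js\<close>, all equal, and their
  number is a multinomial coefficient.\<close>

lemma mc_sum_power:
  assumes a: "\<And>i. mhom ((\<lambda>_. 0)(i := p)) (a i)" and p: "p > 0"
    and I: "finite I" "set js \<subseteq> I"
  shows "multidegree_component (\<lambda>q. p * count (mset js) q) ((\<Sum>i\<in>I. a i) ^ length js) =
    of_nat (card (permutations_of_multiset (mset js))) * prod_list (map a js)"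
proof -
  let ?S = "{l. set l \<subseteq> I \<and> length l = length js}" and ?l = "\<lambda>q. p * count (mset js) q"
  have fin: "finite ?S" by (rule finite_lists_length_eq[OF I(1)])
  have "multidegree_component ?l ((\<Sum>i\<in>I. a i) ^ length js) =
      (\<Sum>l\<in>?S. if mset l = mset js then prod_list (map a js) else 0)"
    unfolding sum_power_lists[OF I(1)] mc_sum
  proof (rule sum.cong)
    fix l
    have "(\<lambda>q. p * count (mset l) q) = ?l \<longleftrightarrow> mset l = mset js"
      using p by (auto simp: fun_eq_iff multiset_eq_iff)
    then show "multidegree_component ?l (prod_list (map a l)) =
        (if mset l = mset js then prod_list (map a js) else 0)"
      using mc_mhom[OF mhom_prod_list_multiset[OF a, of l], of ?l] prod_list_map_mset_eq[of l js a]
      by simp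
  qed simp
  also have "\<dots> = (\<Sum>l\<in>{l \<in> ?S. mset l = mset js}. prod_list (map a js))"
    by (rule sum.inter_filter[OF fin, symmetric])
  also have "{l \<in> ?S. mset l = mset js} = permutations_of_multiset (mset js)"
    using I(2) by (auto simp: permutations_of_multiset_def dest: mset_eq_setD mset_eq_length)
  finally show ?thesis by simp
qed

lemma poly_ring_nabla: "nabla m f \<in> poly_ring m"
proof -
  have "f \<in> generated_algebra (Var ` UNIV)" by (simp flip: vars_subset_iff)
  then show ?thesis
    unfolding nabla_def poly_ring_iff
    by (rule subst_in_generated_algebra)
      (auto intro!: generated_algebra_sum intro: generated_algebra.gen)
qed

definition norm_form :: "nat \<Rightarrow> 'b::comm_ring_1 \<Rightarrow> 'b \<Rightarrow> 'b" where
  "norm_form p x y = y ^ p - y * x ^ (p - 1)"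

context prime_char
begin

text \<open>(x + x')^(p-1) is the sum of the (-1)^k x^k x'^(p-1-k). Splitting off its last or its
  first term gives x^(p-1) + x' h and x'^(p-1) - x h. Using the former next to y and the latter next
  to y' leaves the determinant x y' - x' y times h as the only error.\<close>

lemma norm_form_add:
  fixes x x' y y' :: "('v, 'a) mpoly"
  defines "h \<equiv> (\<Sum>k\<le>p - 2. Const ((- 1) ^ k) * x ^ k * x' ^ (p - 2 - k))"
  shows "norm_form p (x + x') (y + y') =
    norm_form p x y + norm_form p x' y' + (x * y' - x' * y) * h"
proof -
  define q where "q = p - 2"
  have p1: "p - 1 = Suc q" using p_ge_2 by (simp add: q_def)
  let ?c = "\<lambda>k. Const ((- 1) ^ k :: 'a) :: ('v, 'a) mpoly"
  have "(x + x') ^ (p - 1) = (\<Sum>k\<le>p - 1. of_nat (p - 1 choose k) * x ^ k * x' ^ (p - 1 - k))"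
    by (rule binomial_ring)
  also have "\<dots> = (\<Sum>k\<le>p - 1. ?c k * x ^ k * x' ^ (p - 1 - k))"
  proof (rule sum.cong)
    fix k assume "k \<in> {..p - 1}"
    then have "k \<le> p - 1" by simp
    from of_nat_choose_p1[OF this]
    have "of_nat (p - 1 choose k) = ?c k" by (simp only: flip: Const_of_nat)
    then show "of_nat (p - 1 choose k) * x ^ k * x' ^ (p - 1 - k) = ?c k * x ^ k * x' ^ (p - 1 - k)"
      by (simp only:)
  qed simp
  finally have s: "(x + x') ^ (p - 1) = (\<Sum>k\<le>Suc q. ?c k * x ^ k * x' ^ (Suc q - k))"
    unfolding p1 .
  have h: "h = (\<Sum>k\<le>q. ?c k * x ^ k * x' ^ (q - k))"
    by (simp add: h_def q_def)
  have "?c (Suc q) = 1" using minus_one_power_p1 unfolding p1 by simp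
  then have "(x + x') ^ (p - 1) = (\<Sum>k\<le>q. ?c k * x ^ k * x' ^ (Suc q - k)) + x ^ Suc q"
    unfolding s sum.atMost_Suc by simp
  also have "(\<Sum>k\<le>q. ?c k * x ^ k * x' ^ (Suc q - k)) = x' * h"
    unfolding h sum_distrib_left by (rule sum.cong) (simp_all add: Suc_diff_le mult_ac)
  finally have 1: "(x + x') ^ (p - 1) = x' * h + x ^ (p - 1)" unfolding p1 .
  have "(x + x') ^ (p - 1) = x' ^ Suc q + (\<Sum>k\<le>q. ?c (Suc k) * x ^ Suc k * x' ^ (Suc q - Suc k))"
    unfolding s by (subst sum.atMost_Suc_shift) simp
  also have "(\<Sum>k\<le>q. ?c (Suc k) * x ^ Suc k * x' ^ (Suc q - Suc k)) = - (x * h)"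
    unfolding h sum_distrib_left sum_negf[symmetric]
    by (rule sum.cong) (simp_all add: Const_uminus mult_ac)
  finally have 2: "(x + x') ^ (p - 1) = x' ^ (p - 1) - x * h" unfolding p1 by simp
  have "norm_form p (x + x') (y + y') = y ^ p + y' ^ p - y * (x + x') ^ (p - 1) - y' * (x + x') ^ (p - 1)"
    by (simp add: norm_form_def frobenius_add distrib_right)
  also have "\<dots> = y ^ p + y' ^ p - y * (x' * h + x ^ (p - 1)) - y' * (x' ^ (p - 1) - x * h)"
    using 1 2 by simp
  finally show ?thesis by (simp add: norm_form_def algebra_simps)
qed

abbreviation sum_x :: "nat \<Rightarrow> (coord \<times> nat, 'a) mpoly" where "sum_x n \<equiv> \<Sum>i=1..n. xv i"
abbreviation sum_y :: "nat \<Rightarrow> (coord \<times> nat, 'a) mpoly" where "sum_y n \<equiv> \<Sum>i=1..n. yv i"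
abbreviation sum_N :: "nat \<Rightarrow> (coord \<times> nat, 'a) mpoly" where "sum_N n \<equiv> \<Sum>i=1..n. N_inv p i"

lemma sigma_sums [simp]: "sigma (sum_x n) = sum_x n" "sigma (sum_N n) = sum_N n"
  by (induction n) (simp_all add: sigma_add)

lemma poly_ring_sums [simp]: "sum_x m \<in> R" "sum_N m \<in> R"
  by (auto intro!: poly_ring_sum)

text \<open>The copies of V_2 are added one at a time; each step contributes an error that is a sum
  of u's times one P-invariant cofactor.\<close>

lemma norm_form_sum: "n \<le> m \<Longrightarrow> norm_form p (sum_x n) (sum_y n) - sum_N n \<in> u_ideal m"
proof (induction n)
  case 0
  then show ?case using p_ge_2 by (simp add: norm_form_def u_ideal.zero power_0_left)
next
  case (Suc n)
  let ?k = "Suc n"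
  define h where "h = (\<Sum>k\<le>p - 2. Const ((- 1) ^ k :: 'a) * sum_x n ^ k * xv ?k ^ (p - 2 - k))"
  have x: "sum_x n \<in> R" using Suc.prems by (auto intro!: poly_ring_sum)
  have h: "h \<in> R" "sigma h = h"
    using Suc.prems x sigma_sums(1)[of n] unfolding h_def
    by (auto intro!: poly_ring_sum simp: sigma_sum sigma_mult sigma_power)
  have "sum_x n * yv ?k - xv ?k * sum_y n = (\<Sum>i=1..n. u_inv i ?k)"
    by (simp add: u_inv_def sum_distrib_left sum_distrib_right sum_subtractf)
  then have "(sum_x n * yv ?k - xv ?k * sum_y n) * h \<in> u_ideal m"
    using Suc.prems h by (auto simp: sum_distrib_right intro!: u_ideal_sum u_ideal.gen)
  with Suc have "(norm_form p (sum_x n) (sum_y n) - sum_N n) +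
      (sum_x n * yv ?k - xv ?k * sum_y n) * h \<in> u_ideal m"
    by (intro u_ideal.add) simp_all
  moreover have Nk: "norm_form p (xv ?k) (yv ?k) = N_inv p ?k"
    by (simp add: norm_form_def N_inv_def)
  have "sum_x ?k = sum_x n + xv ?k" "sum_y ?k = sum_y n + yv ?k" "sum_N ?k = sum_N n + N_inv p ?k"
    by simp_all
  then have "norm_form p (sum_x ?k) (sum_y ?k) - sum_N ?k =
      (norm_form p (sum_x n) (sum_y n) - sum_N n) + (sum_x n * yv ?k - xv ?k * sum_y n) * h"
    using norm_form_add[of "sum_x n" "xv ?k" "sum_y n" "yv ?k", folded h_def, unfolded Nk] by simp
  ultimately show ?case by (simp only:)
qed

lemma nabla_dickson_N: "nabla m (dickson_N p) = norm_form p (sum_x m) (sum_y m)"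
  by (simp add: nabla_def dickson_N_def norm_form_def subst_simps)

text \<open>The degree is written as a sum of two functions so that L_i (the case i = j) and L_ij
  are treated together. Modulo the u's, nabla of L = x N is the sum of the x_k times the sum of the
  N_l, and the degree singles out one product.\<close>

lemma L_component_eq:
  assumes "i \<in> {1..m}" "j \<in> {1..m}"
  shows "L_component p m (\<lambda>q. ((\<lambda>_. 0)(i := 1)) q + ((\<lambda>_. 0)(j := p)) q) - xv i * N_inv p j
    \<in> (u_ideal m :: (coord \<times> nat, 'a) mpoly set)"
proof -
  let ?d = "\<lambda>i j q. ((\<lambda>_. 0)(i := 1)) q + ((\<lambda>_. 0)(j := p)) (q :: nat)"
  define z where "z = norm_form p (sum_x m) (sum_y m) - sum_N m"
  have z: "z \<in> u_ideal m" unfolding z_def by (rule norm_form_sum) simp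
  have "nabla m (dickson_L p) = sum_x m * nabla m (dickson_N p)"
    by (simp add: dickson_L_def nabla_def subst_mult)
  also have "\<dots> = (\<Sum>k=1..m. \<Sum>l=1..m. xv k * N_inv p l) + z * sum_x m"
    unfolding nabla_dickson_N z_def sum_product[symmetric] by (simp add: algebra_simps)
  finally have "L_component p m (?d i j) =
      (\<Sum>k=1..m. \<Sum>l=1..m. multidegree_component (?d i j) (xv k * N_inv p l))
      + multidegree_component (?d i j) (z * sum_x m)"
    by (simp only: L_component_def mc_add mc_sum)
  also have "(\<Sum>k=1..m. \<Sum>l=1..m. multidegree_component (?d i j) (xv k * N_inv p l)) =
      (\<Sum>k=1..m. \<Sum>l=1..m. if k = i then if l = j then xv i * N_inv p j else 0 else (0 :: (coord \<times> nat, 'a) mpoly))"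
  proof (intro sum.cong refl)
    fix k l
    have "?d k l = ?d i j \<Longrightarrow> k = i \<and> l = j"
    proof -
      assume eq: "?d k l = ?d i j"
      \<comment> \<open>At j the degree is at least p > 1, while x_k alone contributes at most
        1.\<close>
      have "l = j" using fun_cong[OF eq, of j] p_ge_2 by (auto split: if_splits)
      with fun_cong[OF eq, of i] show ?thesis by (auto split: if_splits)
    qed
    then have "?d k l = ?d i j \<longleftrightarrow> k = i \<and> l = j" by blast
    moreover have mh: "mhom (?d k l) (xv k * N_inv p l :: (coord \<times> nat, 'a) mpoly)"
      by (intro mhom_mult mhom_Var mhom_N_inv) (use p_ge_2 in simp)
    ultimately show "multidegree_component (?d i j) (xv k * N_inv p l) =
        (if k = i then if l = j then xv i * N_inv p j else 0 else (0 :: (coord \<times> nat, 'a) mpoly))"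
      using mc_mhom[OF mh, of "?d i j"] by auto
  qed
  also have "\<dots> = (\<Sum>k=1..m. if k = i then xv i * N_inv p j else 0)"
    using assms by (intro sum.cong refl) simp
  also have "\<dots> = xv i * N_inv p j"
    using assms by simp
  finally have "L_component p m (?d i j) - xv i * N_inv p j = multidegree_component (?d i j) (z * sum_x m)"
    by simp
  then show ?thesis
    using u_ideal_mc[OF u_ideal_mult[OF z poly_ring_sums(1) sigma_sums(1)], of "?d i j"] by (simp only:)
qed

lemma L_component_in_S_gens:
  assumes "i \<in> {1..m}" "j \<in> {1..m}"
  shows "L_component p m (\<lambda>q. ((\<lambda>_. 0)(i := 1)) q + ((\<lambda>_. 0)(j := p)) q) \<in> S_gens p m"
proof (cases "i = j")
  case True
  then have "(\<lambda>q. ((\<lambda>_. 0)(i := 1)) q + ((\<lambda>_. 0)(j := p)) q) = (\<lambda>_. 0)(i := p + 1)"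
    by auto
  then show ?thesis unfolding S_gens_def L_single_def[symmetric] using assms by (auto simp: L_single_def)
next
  case False
  then have "(\<lambda>q. ((\<lambda>_. 0)(i := 1)) q + ((\<lambda>_. 0)(j := p)) q) = (\<lambda>_. 0)(i := 1, j := p)"
    by auto
  then have "L_component p m (\<lambda>q. ((\<lambda>_. 0)(i := 1)) q + ((\<lambda>_. 0)(j := p)) q) = L_pair p m i j"
    by (simp only: L_pair_def)
  then show ?thesis unfolding S_gens_def using assms False by auto
qed

text \<open>The list \<open>js\<close> encodes lambda / p as a multiset of size p - 1. Frobenius
  turns the p(p-1)-th power of the sum of the x_i into the (p-1)-th power of the sum of the x_i^p,
  so both terms of D produce the same multinomial coefficient; it divides (p - 1)! and is thus
  nonzero in F.\<close>

lemma D_component_eq: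
  assumes "set js \<subseteq> {1..m}" "length js = p - 1"
  shows "\<exists>c::'a. c \<noteq> 0 \<and> D_component p m (\<lambda>q. p * count (mset js) q) -
    Const c * (N_prod p js + prod_list (map (\<lambda>j. xv j ^ p) js)) \<in> u_ideal m"
proof -
  let ?l = "\<lambda>q. p * count (mset js) q"
  let ?n = "card (permutations_of_multiset (mset js))"
  define z where "z = norm_form p (sum_x m) (sum_y m) - sum_N m"
  have z: "z \<in> u_ideal m" unfolding z_def by (rule norm_form_sum) simp
  define w where "w = (sum_N m + z) ^ (p - 1) - sum_N m ^ (p - 1)"
  have w: "w \<in> u_ideal m" unfolding w_def by (rule u_ideal_power_diff[OF poly_ring_sums(2) sigma_sums(2) z])
  have "nabla m (dickson_D p) = (sum_N m + z) ^ (p - 1) + sum_x m ^ (p * (p - 1))"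
  proof -
    have "nabla m (dickson_D p) = nabla m (dickson_N p) ^ (p - 1) + sum_x m ^ (p * (p - 1))"
      by (simp add: dickson_D_def nabla_def subst_simps)
    then show ?thesis unfolding nabla_dickson_N z_def by simp
  qed
  also have "\<dots> = sum_N m ^ (p - 1) + (\<Sum>i=1..m. xv i ^ p) ^ (p - 1) + w"
    by (simp add: w_def power_mult frobenius_sum)
  finally have "D_component p m ?l = multidegree_component ?l (sum_N m ^ length js) +
      multidegree_component ?l ((\<Sum>i=1..m. xv i ^ p) ^ length js) + multidegree_component ?l w"
    unfolding D_component_def assms(2) by (simp only: mc_add)
  also have "multidegree_component ?l (sum_N m ^ length js) = of_nat ?n * N_prod p js"
    by (rule mc_sum_power[OF mhom_N_inv]) (use p_ge_2 assms in auto)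
  also have "multidegree_component ?l ((\<Sum>i=1..m. xv i ^ p) ^ length js) =
      of_nat ?n * prod_list (map (\<lambda>j. xv j ^ p) js :: (coord \<times> nat, 'a) mpoly list)"
  proof (rule mc_sum_power)
    fix i :: nat
    have "(\<lambda>l. p * ((\<lambda>_. 0)(i := 1)) l) = (\<lambda>_. 0)(i := p)" by auto
    then show "mhom ((\<lambda>_. 0)(i := p)) (xv i ^ p)"
      using mhom_power[OF mhom_Var] by metis
  qed (use p_ge_2 assms in auto)
  finally have "D_component p m ?l -
      Const (of_nat ?n) * (N_prod p js + prod_list (map (\<lambda>j. xv j ^ p) js)) = multidegree_component ?l w"
    by (simp add: Const_of_nat distrib_left)
  moreover have "(of_nat ?n :: 'a) \<noteq> 0"
  proof
    assume "(of_nat ?n :: 'a) = 0"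
    then have "p dvd ?n" by (simp only: of_nat_eq_0)
    then have "p dvd fact (size (mset js))"
      by (metis card_permutations_of_multiset_aux dvd_mult2)
    then show False using assms(2) prime_p p_ge_2 by (simp add: prime_dvd_fact_iff)
  qed
  ultimately show ?thesis using u_ideal_mc[OF w, of ?l] by (intro exI[of _ "of_nat ?n"]) simp
qed

lemma D_component_in_S_gens:
  assumes "set js \<subseteq> {1..m}" "length js = p - 1"
  shows "D_component p m (\<lambda>q. p * count (mset js) q) \<in> S_gens p m"
proof -
  have "(\<Sum>i=1..m. p * count (mset js) i) = p * (\<Sum>i=1..m. count (mset js) i)"
    by (simp add: sum_distrib_left)
  also have "(\<Sum>i=1..m. count (mset js) i) = (\<Sum>i\<in>set js. count (mset js) i)"
    using assms(1) by (intro sum.mono_neutral_right) (auto simp: count_eq_zero_iff)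
  also have "\<dots> = size (mset js)"
    by (simp add: size_multiset_overloaded_eq)
  finally have "(\<lambda>q. p * count (mset js) q) \<in> D_degrees p m"
    using assms by (auto simp: D_degrees_def count_eq_zero_iff)
  then show ?thesis by (simp add: S_gens_def)
qed

end

subsection \<open>Invariance of the generators\<close>

text \<open>A linear order on the variables makes \<open>(coord, 'a) mpoly\<close> an integral
  domain; this permits cancelling L in \<open>dickson_D_invariant\<close>.\<close>

instantiation coord :: linorder
begin

definition less_eq_coord :: "coord \<Rightarrow> coord \<Rightarrow> bool" where "less_eq_coord a b \<longleftrightarrow> a = X \<or> b = Y"
definition less_coord :: "coord \<Rightarrow> coord \<Rightarrow> bool" where "less_coord a b \<longleftrightarrow> a = X \<and> b = Y"

instance
proof
  fix a b c :: coord
  show "a < b \<longleftrightarrow> a \<le> b \<and> \<not> b \<le> a" "a \<le> a" "a \<le> b \<Longrightarrow> b \<le> c \<Longrightarrow> a \<le> c"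
    "a \<le> b \<Longrightarrow> b \<le> a \<Longrightarrow> a = b" "a \<le> b \<or> b \<le> a"
    by (cases a; cases b; cases c; simp add: less_eq_coord_def less_coord_def)+
qed

end

fun act_coord_var :: "'a::field ^ 2 ^ 2 \<Rightarrow> coord \<Rightarrow> (coord, 'a) mpoly" where
  "act_coord_var g Y = Const (g $ 2 $ 2) * Var Y - Const (g $ 1 $ 2) * Var X"
| "act_coord_var g X = Const (g $ 1 $ 1) * Var X - Const (g $ 2 $ 1) * Var Y"

lemma act_nabla: "act g (nabla m f) = nabla m (subst (act_coord_var g) f)"
  unfolding act_def nabla_def subst_subst
proof (rule arg_cong[of _ _ "\<lambda>s. subst s f"], rule ext)
  fix c
  show "subst (act_var g) (\<Sum>i=1..m. Var (c, i)) = subst (\<lambda>c. \<Sum>i=1..m. Var (c, i)) (act_coord_var g c)"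
    by (cases c) (simp_all add: subst_simps sum_distrib_left sum_subtractf)
qed

lemma SL2p_Const_det:
  assumes "g \<in> SL2p"
  shows "Const (g $ 1 $ 1) * Const (g $ 2 $ 2) - Const (g $ 1 $ 2) * Const (g $ 2 $ 1) = 1"
  using assms by (simp add: SL2p_iff flip: Const_mult Const_diff)

lemma act_u_inv:
  assumes "g \<in> SL2p"
  shows "act g (u_inv i k) = u_inv i k"
proof -
  have "act g (u_inv i k) = (Const (g $ 1 $ 1) * Const (g $ 2 $ 2) - Const (g $ 1 $ 2) * Const (g $ 2 $ 1)) * u_inv i k"
    by (simp add: u_inv_def act_simps algebra_simps)
  then show ?thesis by (simp add: SL2p_Const_det[OF assms])
qed

lemma act_transfer:
  assumes "g \<in> SL2p"
  shows "act g (transfer f) = transfer f"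
proof -
  define h where "h = mat2 (g $ 2 $ 2) (- g $ 1 $ 2) (- g $ 2 $ 1) (g $ 1 $ 1)"
  have h: "h \<in> SL2p" using assms by (simp add: SL2p_iff h_def mult.commute)
  have gh: "g ** h = mat 1" "h ** g = mat 1"
    using assms by (simp_all add: SL2p_iff mat2_eq_iff mat2_mult_nth h_def mat_def algebra_simps)
  have "act g (transfer f) = (\<Sum>k\<in>SL2p. act (g ** k) f)"
    by (simp add: transfer_def act_simps act_act)
  also have "\<dots> = transfer f"
    unfolding transfer_def
    by (rule sum.reindex_bij_witness[of _ "\<lambda>k. h ** k" "\<lambda>k. g ** k"])
      (simp_all add: matrix_mul_assoc gh SL2p_mult assms h)
  finally show ?thesis .
qed

lemma invariants_iff: "f \<in> invariants m \<longleftrightarrow> f \<in> poly_ring m \<and> (\<forall>g\<in>SL2p. act g f = f)"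
  by (simp add: invariants_def)

lemma generated_algebra_invariants:
  assumes "S \<subseteq> invariants m"
  shows "generated_algebra S \<subseteq> invariants m"
proof
  fix f assume "f \<in> generated_algebra S"
  then show "f \<in> invariants m"
    by induction (use assms in \<open>auto simp: invariants_iff act_simps\<close>)
qed

lemma mc_nabla_invariant:
  assumes "\<And>g. g \<in> SL2p \<Longrightarrow> subst (act_coord_var g) f = f"
  shows "multidegree_component l (nabla m f) \<in> invariants m"
  by (simp add: invariants_iff poly_ring_mc poly_ring_nabla act_nabla assms flip: mc_act)

context prime_char
begin

section \<open>Invariance of the Dickson polynomials\<close>

lemma frobenius_diff: "(f - g) ^ p = f ^ p - (g :: ('v, 'a) mpoly) ^ p"
  using frobenius_add[of "f - g" g] by (simp add: algebra_simps)

text \<open>The form is the determinant of the rows (x, y) and (x^q, y^q). The entries of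
  \<open>g\<close> are fixed by the q-th power, so both rows transform by the same matrix and the
  form is multiplied by det g = 1.\<close>

lemma dickson_form_invariant:
  assumes q: "\<And>f g :: (coord, 'a) mpoly. (f - g) ^ q = f ^ q - g ^ q"
    "\<And>a::'a. a \<in> \<int> \<Longrightarrow> a ^ q = a" and g: "g \<in> SL2p"
  shows "subst (act_coord_var g) (Var X * Var Y ^ q - Var X ^ q * Var Y) =
    (Var X * Var Y ^ q - Var X ^ q * Var Y :: (coord, 'a) mpoly)"
proof -
  have c: "Const (g $ i $ j) ^ q = Const (g $ i $ j)" for i j
    using g q(2) by (simp add: SL2p_def flip: Const_power)
  have "subst (act_coord_var g) (Var X * Var Y ^ q - Var X ^ q * Var Y) =
    (Const (g $ 1 $ 1) * Const (g $ 2 $ 2) - Const (g $ 1 $ 2) * Const (g $ 2 $ 1)) *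
    (Var X * Var Y ^ q - Var X ^ q * Var Y)"
    by (simp add: subst_simps q(1) power_mult_distrib c) (simp add: algebra_simps)
  then show ?thesis by (simp add: SL2p_Const_det[OF g])
qed

lemma dickson_L_eq: "(dickson_L p :: (coord, 'a) mpoly) = Var X * Var Y ^ p - Var X ^ p * Var Y"
proof -
  have "(Var X :: (coord, 'a) mpoly) ^ p = Var X * Var X ^ (p - 1)"
    using p_ge_2 by (metis Suc_diff_1 less_le_trans pos2 power_Suc)
  then show ?thesis by (simp add: dickson_L_def dickson_N_def algebra_simps)
qed

text \<open>The formula for D does not show its invariance. But L D has the same shape x y^q - x^q y
  as L, with q = p^2 in place of p, so D is a quotient of two invariants.\<close>

lemma dickson_L_mult_D: "dickson_L p * dickson_D p =
    (Var X * Var Y ^ (p * p) - Var X ^ (p * p) * Var Y :: (coord, 'a) mpoly)"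
proof -
  let ?x = "Var X :: (coord, 'a) mpoly" and ?y = "Var Y :: (coord, 'a) mpoly"
  let ?N = "dickson_N p :: (coord, 'a) mpoly"
  have N: "?N * ?N ^ (p - 1) = ?N ^ p"
    using p_ge_2 by (metis Suc_diff_1 less_le_trans pos2 power_Suc)
  have Np: "?N ^ p = ?y ^ (p * p) - ?y ^ p * ?x ^ (p * (p - 1))"
    by (simp add: dickson_N_def frobenius_diff power_mult_distrib mult.commute flip: power_mult)
  have e: "Suc (p - 1 + p * (p - 1)) = p * p"
    using p_ge_2 by (cases p) auto
  have x: "?x * (?x ^ (p - 1) * ?x ^ (p * (p - 1))) = ?x ^ (p * p)"
    unfolding power_add[symmetric] power_Suc[symmetric] e ..
  have "dickson_L p * dickson_D p = ?x * (?N ^ p + ?N * ?x ^ (p * (p - 1)))"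
    by (simp only: dickson_L_def dickson_D_def distrib_left mult.assoc N)
  also have "\<dots> = ?x * ?y ^ (p * p) - ?x * (?x ^ (p - 1) * ?x ^ (p * (p - 1))) * ?y"
    unfolding Np unfolding dickson_N_def by (simp only: algebra_simps)
  finally show ?thesis unfolding x .
qed

lemma dickson_L_invariant:
  assumes "g \<in> SL2p"
  shows "subst (act_coord_var g) (dickson_L p) = (dickson_L p :: (coord, 'a) mpoly)"
  unfolding dickson_L_eq
  by (rule dickson_form_invariant[OF frobenius_diff Ints_power_p assms])

lemma dickson_L_nonzero: "dickson_L p \<noteq> (0 :: (coord, 'a) mpoly)"
proof -
  have "subst (\<lambda>c. if c = X then 0 else 1) (dickson_N p) = (1 :: (coord, 'a) mpoly)"
    using p_ge_2 by (simp add: dickson_N_def subst_simps power_0_left)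
  then have "dickson_N p \<noteq> (0 :: (coord, 'a) mpoly)" by auto
  moreover have "subst (\<lambda>_. 1) (Var X :: (coord, 'a) mpoly) = (1 :: (coord, 'a) mpoly)" by simp
  then have "(Var X :: (coord, 'a) mpoly) \<noteq> 0" by (metis subst_0 zero_neq_one)
  ultimately show ?thesis by (simp add: dickson_L_def)
qed

lemma dickson_D_invariant:
  assumes "g \<in> SL2p"
  shows "subst (act_coord_var g) (dickson_D p) = (dickson_D p :: (coord, 'a) mpoly)"
proof -
  have "subst (act_coord_var g) (dickson_L p * dickson_D p) = (dickson_L p * dickson_D p :: (coord, 'a) mpoly)"
    unfolding dickson_L_mult_D
  proof (rule dickson_form_invariant[OF _ _ assms])
    show "(f - g) ^ (p * p) = f ^ (p * p) - g ^ (p * p)" for f g :: "(coord, 'a) mpoly"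
      by (simp add: power_mult frobenius_diff)
    show "a \<in> \<int> \<Longrightarrow> a ^ (p * p) = a" for a :: 'a
      by (simp add: power_mult Ints_power_p)
  qed
  then show ?thesis
    using dickson_L_nonzero by (simp add: subst_mult dickson_L_invariant[OF assms])
qed

lemma S_gens_invariant: "(S_gens p m :: (coord \<times> nat, 'a) mpoly set) \<subseteq> invariants m"
proof -
  have "(L_component p m l :: (coord \<times> nat, 'a) mpoly) \<in> invariants m" for l
    unfolding L_component_def by (rule mc_nabla_invariant[OF dickson_L_invariant])
  moreover have "(D_component p m l :: (coord \<times> nat, 'a) mpoly) \<in> invariants m" for l
    unfolding D_component_def by (rule mc_nabla_invariant[OF dickson_D_invariant])
  moreover have "(u_inv i j :: (coord \<times> nat, 'a) mpoly) \<in> invariants m" if "1 \<le> i" "i < j" "j \<le> m" for i j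
    using that by (simp add: invariants_iff act_u_inv)
  ultimately show ?thesis
    unfolding S_gens_def L_single_def L_pair_def by blast
qed

lemma transfer_invariant: "f \<in> R \<Longrightarrow> transfer f \<in> invariants m"
  unfolding invariants_iff
  by (auto simp: act_transfer) (simp add: transfer_def poly_ring_sum poly_ring_act)

subsection \<open>The invariants as relative transfers\<close>

abbreviation alg :: "(coord \<times> nat, 'a) mpoly set" where
  "alg \<equiv> generated_algebra (S_gens p m \<union> transfer ` R)"

lemma u_inv_alg:
  assumes "a \<in> {1..m}" "b \<in> {1..m}"
  shows "u_inv a b \<in> alg"
proof -
  have *: "u_inv i j \<in> alg" if "1 \<le> i" "i < j" "j \<le> m" for i j
    using that by (intro generated_algebra.gen) (auto simp: S_gens_def)
  consider "a < b" | "b < a" | "a = b" by linarith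
  then show ?thesis
  proof cases
    case 2
    then have "- u_inv b a \<in> alg" using * assms by (intro generated_algebra_uminus) auto
    then show ?thesis by (simp flip: u_inv_swap)
  next
    case 3
    then show ?thesis using generated_algebra.const[of 0] by simp
  qed (use * assms in auto)
qed

lemma act_alg_gen: "f \<in> S_gens p m \<Longrightarrow> g \<in> SL2p \<Longrightarrow> act g f = (f :: (coord \<times> nat, 'a) mpoly)"
  using S_gens_invariant by (auto simp: invariants_iff)

lemma rel_transfer_tr: "h \<in> R \<Longrightarrow> rel_transfer ((Delta ^^ (p - 1)) h) \<in> alg"
  unfolding transfer_eq_rel_transfer[symmetric] by (auto intro: generated_algebra.gen)

text \<open>u_ab is invariant under the whole group, so it comes out of the relative transfer and
  leaves a P-invariant of smaller degree. \<open>IH\<close> stands for the induction hypothesis of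
  \<open>rel_transfer_alg\<close>.\<close>

lemma u_ideal_rel_transfer:
  assumes IH: "\<And>s f. (\<Sum>i\<in>{1..m}. s i) < (\<Sum>i\<in>{1..m}. r i) \<Longrightarrow> f \<in> R \<Longrightarrow> mhom s f \<Longrightarrow>
      sigma f = f \<Longrightarrow> rel_transfer f \<in> alg"
    and z: "z \<in> u_ideal m" "mhom r z"
  shows "rel_transfer z \<in> alg"
proof -
  \<comment> \<open>The summands of z need not be homogeneous, so the rule induction is run on
    components.\<close>
  have "rel_transfer (multidegree_component r z) \<in> alg"
    using z(1)
  proof (induction rule: u_ideal.induct)
    case zero
    then show ?case using generated_algebra.const[of 0] by simp
  next
    case (add f g)
    then show ?case by (simp add: mc_add rel_transfer_add generated_algebra.add)
  next
    case (gen a b f)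
    show ?case
    proof (rule mc_mult_mhom_cases[OF mhom_u_inv, of r a b f])
      assume "multidegree_component r (u_inv a b * f) = 0"
      then show ?thesis using generated_algebra.const[of 0] by simp
    next
      fix s
      let ?f = "multidegree_component s f"
      assume r: "r = (\<lambda>i. ((\<lambda>_. 0)(a := 1)) i + ((\<lambda>_. 0)(b := 1)) i + s i)"
        and eq: "multidegree_component r (u_inv a b * f) = u_inv a b * ?f"
      have "(\<Sum>i\<in>{1..m}. s i) < (\<Sum>i\<in>{1..m}. r i)"
        by (rule sum_strict_mono_ex1) (use gen(1) in \<open>auto simp: r\<close>)
      moreover have "sigma ?f = ?f"
        using gen(4) mc_Delta[of s f] by (simp flip: Delta_eq_0_iff)
      ultimately have "rel_transfer ?f \<in> alg"
        using IH[of s ?f] poly_ring_mc[OF gen(3)] mhom_mc by blast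
      then have "u_inv a b * rel_transfer ?f \<in> alg"
        by (rule generated_algebra.mult[OF u_inv_alg[OF gen(1,2)]])
      then show ?thesis unfolding eq by (simp add: rel_transfer_mult act_u_inv)
    qed
  qed
  then show ?thesis by (simp add: mc_same[OF z(2)])
qed

text \<open>
  The relative transfer is linear over the invariants, so every factor \<open>u\<^sub>i\<^sub>j\<close>, \<open>x\<^sub>i N\<^sub>j\<close> or product of
  \<open>p - 1\<close> norms can be replaced by a generator modulo invariants of lower degree. What is left are
  monomials that are transfers or have nontrivial weight.
\<close>

theorem rel_transfer_alg:
  assumes "f \<in> R" "mhom r f" "sigma f = f"
  shows "rel_transfer f \<in> alg"
  using assms
proof (induction "\<Sum>i\<in>{1..m}. r i" arbitrary: r f rule: less_induct)
  case (less r f)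
  have p1: "p \<ge> 1" using p_ge_2 by simp
  have IH: "rel_transfer f \<in> alg"
    if "(\<Sum>i\<in>{1..m}. s i) < (\<Sum>i\<in>{1..m}. r i)" "f \<in> R" "mhom s f" "sigma f = f" for s f
    using less.hyps that by blast
  have u_ideal_step: "rel_transfer z \<in> alg" if "z \<in> u_ideal m" "mhom r z" for z
    by (rule u_ideal_rel_transfer[OF IH that])
  have zero: "0 \<in> alg" using generated_algebra.const[of 0] by simp
  \<comment> \<open>The generator comes out of the relative transfer; \<open>d i > 0\<close> ensures
    that h has smaller degree.\<close>
  have generator: "rel_transfer (l * h) \<in> alg"
    if l: "l \<in> S_gens p m" and h: "h \<in> R" "sigma h = h" "mhom s h"
      and s: "r = (\<lambda>i. d i + s i)" "i \<in> {1..m}" "d i > 0" for l h d s i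
  proof -
    have "(\<Sum>i\<in>{1..m}. s i) < (\<Sum>i\<in>{1..m}. r i)"
      by (rule sum_strict_mono_ex1) (use s in auto)
    from IH[OF this h(1,3,2)] have "l * rel_transfer h \<in> alg"
      using l by (auto intro: generated_algebra.mult[OF generated_algebra.gen])
    then show ?thesis by (simp add: rel_transfer_mult act_alg_gen[OF l])
  qed
  have mixed: "rel_transfer (xv i * N_inv p j * h) \<in> alg"
    if ij: "i \<in> {1..m}" "j \<in> {1..m}" and h: "h \<in> R" "sigma h = h" "mhom s h"
      and r: "mhom r (xv i * N_inv p j * h)" for i j h s
  proof (cases "xv i * N_inv p j * h = 0")
    case True
    then show ?thesis using zero by simp
  next
    case False
    let ?d = "\<lambda>q. ((\<lambda>_. 0)(i := 1)) q + ((\<lambda>_. 0)(j := p)) q"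
    have d: "mhom ?d (xv i * N_inv p j :: (coord \<times> nat, 'a) mpoly)"
      by (intro mhom_mult mhom_Var mhom_N_inv p1)
    \<comment> \<open>A nonzero homogeneous polynomial has only one multidegree, which determines
      r.\<close>
    have rs: "r = (\<lambda>q. ?d q + s q)"
      using mc_mhom[OF mhom_mult[OF d h(3)], of r] mc_same[OF r] False by (auto split: if_splits)
    let ?L = "L_component p m ?d :: (coord \<times> nat, 'a) mpoly"
    let ?z = "?L - xv i * N_inv p j"
    have "mhom ?d ?z" by (intro mhom_diff d) (simp only: L_component_def mhom_mc)
    then have "mhom r (?z * h)" unfolding rs by (rule mhom_mult[OF _ h(3)])
    then have "rel_transfer (?z * h) \<in> alg"
      by (intro u_ideal_step u_ideal_mult[OF L_component_eq[OF ij] h(1,2)])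
    moreover have "rel_transfer (?L * h) \<in> alg"
      by (rule generator[OF L_component_in_S_gens[OF ij] h rs ij(1)]) simp
    ultimately have "rel_transfer (?L * h) - rel_transfer (?z * h) \<in> alg"
      by (intro generated_algebra_diff)
    then show ?thesis by (simp add: left_diff_distrib rel_transfer_diff)
  qed
  have long_x: "rel_transfer (x_prod xs) \<in> alg" if xs: "set xs \<subseteq> {1..m}" "p - 1 \<le> length xs" for xs
    using long_x_prod_transfer[OF xs] rel_transfer_tr by auto
  have both: "rel_transfer (x_prod xs * N_prod p js) \<in> alg"
    if xs: "set xs \<subseteq> {1..m}" "xs \<noteq> []" and js: "set js \<subseteq> {1..m}" "js \<noteq> []"
      and r: "mhom r (x_prod xs * N_prod p js :: (coord \<times> nat, 'a) mpoly)" for xs js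
  proof -
    obtain i xs' where x: "xs = i # xs'" using xs by (cases xs) auto
    obtain j js' where j: "js = j # js'" using js by (cases js) auto
    let ?h = "x_prod xs' * N_prod p js' :: (coord \<times> nat, 'a) mpoly"
    have eq: "x_prod xs * N_prod p js = xv i * N_inv p j * ?h" by (simp add: x j mult_ac)
    obtain s1 s2 where "mhom s1 (x_prod xs' :: (coord \<times> nat, 'a) mpoly)"
      "mhom s2 (N_prod p js' :: (coord \<times> nat, 'a) mpoly)"
      using mhom_x_prod mhom_N_prod[OF p1] by metis
    then have s: "mhom (\<lambda>q. s1 q + s2 q) ?h" by (rule mhom_mult)
    show ?thesis unfolding eq
    proof (rule mixed[OF _ _ _ _ s])
      show "mhom r (xv i * N_inv p j * ?h)" using r by (simp only: eq)
    qed (use xs js x j in \<open>simp_all add: poly_ring_products sigma_mult\<close>)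
  qed
  have norms: "rel_transfer (N_prod p js) \<in> alg"
    if js: "set js \<subseteq> {1..m}" "p - 1 \<le> length js" and r: "mhom r (N_prod p js :: (coord \<times> nat, 'a) mpoly)" for js
  proof (cases "N_prod p js = (0 :: (coord \<times> nat, 'a) mpoly)")
    case True
    then show ?thesis using zero by simp
  next
    case False
    define j1 where "j1 = take (p - 1) js"
    define j2 where "j2 = drop (p - 1) js"
    have js12: "js = j1 @ j2" by (simp add: j1_def j2_def)
    then have sub: "set j1 \<subseteq> {1..m}" "set j2 \<subseteq> {1..m}" using js(1) by auto
    have len: "length j1 = p - 1" using js(2) by (simp add: j1_def)
    let ?h = "N_prod p j2 :: (coord \<times> nat, 'a) mpoly"
    let ?d = "\<lambda>q. p * count (mset j1) q"
    let ?X = "prod_list (map (\<lambda>j. xv j ^ p) j1) :: (coord \<times> nat, 'a) mpoly"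
    have h: "?h \<in> R" "sigma ?h = ?h" using poly_ring_products(3)[OF sub(2)] by simp_all
    obtain s where s: "mhom s ?h" using mhom_N_prod[OF p1] by blast
    have d1: "mhom ?d (N_prod p j1 :: (coord \<times> nat, 'a) mpoly)"
      by (rule mhom_prod_list_multiset[OF mhom_N_inv[OF p1]])
    have d2: "mhom ?d ?X"
    proof (rule mhom_prod_list_multiset)
      fix i :: nat
      have "(\<lambda>l. p * ((\<lambda>_. 0)(i := 1)) l) = (\<lambda>_. 0)(i := p)" by auto
      then show "mhom ((\<lambda>_. 0)(i := p)) (xv i ^ p :: (coord \<times> nat, 'a) mpoly)"
        using mhom_power[OF mhom_Var] by metis
    qed
    have N12: "N_prod p js = N_prod p j1 * ?h" by (simp add: js12)
    have rs: "r = (\<lambda>q. ?d q + s q)"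
      using mc_mhom[OF mhom_mult[OF d1 s], of r] mc_same[OF r] False unfolding N12
      by (auto split: if_splits)
    let ?D = "D_component p m ?d :: (coord \<times> nat, 'a) mpoly"
    obtain c :: 'a where c: "c \<noteq> 0" "?D - Const c * (N_prod p j1 + ?X) \<in> u_ideal m"
      using D_component_eq[OF sub(1) len] by blast
    let ?z = "?D - Const c * (N_prod p j1 + ?X)"
    have "mhom ?d ?z"
      by (intro mhom_diff mhom_Const_mult mhom_add d1 d2) (simp only: D_component_def mhom_mc)
    then have "mhom r (?z * ?h)" unfolding rs by (rule mhom_mult[OF _ s])
    then have z: "rel_transfer (?z * ?h) \<in> alg"
      by (intro u_ideal_step u_ideal_mult[OF c(2) h])
    have "j1 \<noteq> []" using len p_ge_2 by auto
    then obtain i where i: "i \<in> set j1" by (cases j1) auto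
    have D: "rel_transfer (?D * ?h) \<in> alg"
      by (rule generator[OF D_component_in_S_gens[OF sub(1) len] h s rs, of i])
        (use i sub p_ge_2 in auto)
    \<comment> \<open>The x-part of D, each x_j being repeated p times. If norms remain,
      \<open>both\<close> applies; otherwise the length p (p - 1) makes it a transfer from
      P.\<close>
    define xs where "xs = concat (map (replicate p) j1)"
    have "(x_prod (replicate p j) :: (coord \<times> nat, 'a) mpoly) = xv j ^ p" for j
      by (induction p) simp_all
    then have X: "?X = x_prod xs" unfolding xs_def by (induction j1) simp_all
    have xs: "set xs \<subseteq> {1..m}" "length xs = p * length j1"
      using sub(1) unfolding xs_def by (induction j1) auto
    have Xh: "rel_transfer (?X * ?h) \<in> alg"
    proof (cases "j2 = []")
      case True
      then show ?thesis unfolding X using long_x[OF xs(1)] xs(2) len p_ge_2 by simp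
    next
      case False
      show ?thesis unfolding X
      proof (rule both[OF xs(1) _ sub(2) False])
        show "xs \<noteq> []" using xs(2) len p_ge_2 by auto
        show "mhom r (x_prod xs * ?h)" unfolding rs X[symmetric] by (rule mhom_mult[OF d2 s])
      qed
    qed
    have "Const (1 / c) * Const c = (1 :: (coord \<times> nat, 'a) mpoly)"
      using c(1) by (simp flip: Const_mult)
    \<comment> \<open>Solves the definition of \<open>?z\<close> for the product of p - 1 norms, in
      terms of the generator, the error term and the x-monomial.\<close>
    then have e: "Const (1 / c) * (?D - ?z) - ?X = N_prod p j1"
      by (simp add: mult.assoc[symmetric])
    have distrib: "(a * (d - z) - x) * k = a * (d * k - z * k) - x * k"
      for a d z x k :: "(coord \<times> nat, 'a) mpoly"
      by (simp add: algebra_simps)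
    have "N_prod p js = Const (1 / c) * (?D * ?h - ?z * ?h) - ?X * ?h"
      unfolding distrib[symmetric] e N12 ..
    then have "rel_transfer (N_prod p js) =
        Const (1 / c) * (rel_transfer (?D * ?h) - rel_transfer (?z * ?h)) - rel_transfer (?X * ?h)"
      by (simp only: rel_transfer_diff rel_transfer_mult act_simps)
    then show ?thesis
      using D z Xh by (simp only: generated_algebra_diff generated_algebra.mult generated_algebra.const)
  qed
  have "(Delta ^^ 0) f \<in> G 0"
    by (rule sylow_invariants_span) (use less.prems p_ge_2 in \<open>simp_all add: Delta_eq_0_iff\<close>)
  then have "f \<in> G 0" by simp
  then have "rel_transfer (multidegree_component r f) \<in> alg"
  proof (induction rule: sylow_span.induct)
    case (tr h)
    then show ?case by (simp only: mc_Dn rel_transfer_tr poly_ring_mc)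
  next
    case (add f g)
    then show ?case by (simp add: mc_add rel_transfer_add generated_algebra.add)
  next
    case (mon xs us js c)
    let ?M = "x_prod xs * u_prod us * N_prod p js :: (coord \<times> nat, 'a) mpoly"
    obtain r1 r2 r3 where "mhom r1 (x_prod xs :: (coord \<times> nat, 'a) mpoly)"
      "mhom r2 (u_prod us :: (coord \<times> nat, 'a) mpoly)" "mhom r3 (N_prod p js :: (coord \<times> nat, 'a) mpoly)"
      using mhom_x_prod mhom_u_prod mhom_N_prod[OF p1] by metis
    then have M: "mhom (\<lambda>i. r1 i + r2 i + r3 i) ?M" by (intro mhom_mult)
    have "rel_transfer (multidegree_component r ?M) \<in> alg"
    proof (cases "(\<lambda>i. r1 i + r2 i + r3 i) = r")
      case False
      then show ?thesis using mc_mhom[OF M, of r] zero by simp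
    next
      case True
      then have r: "mhom r ?M" using M by simp
      have "rel_transfer ?M \<in> alg"
      proof (cases us)
        case (Cons u us')
        obtain a b where u: "u = (a, b)" by (cases u)
        have "u_inv a b * (x_prod xs * u_prod us' * N_prod p js) \<in> (u_ideal m :: (coord \<times> nat, 'a) mpoly set)"
          by (rule u_ideal.gen) (use mon Cons u in \<open>auto simp: poly_ring_products sigma_mult\<close>)
        also have "u_inv a b * (x_prod xs * u_prod us' * N_prod p js) = ?M"
          by (simp add: Cons u mult_ac)
        finally show ?thesis using u_ideal_step r by blast
      next
        case Nil
        show ?thesis
        proof (cases js)
          case js: Nil
          consider "xs = []" | "0 < length xs" "length xs < p - 1" | "p - 1 \<le> length xs"
            by (metis length_greater_0_conv not_less)
          then show ?thesis
          proof cases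
            case 1
            have "rel_transfer ?M = rel_transfer (Const 1 * 1)" by (simp add: 1 Nil js)
            also have "\<dots> = - Const 1" by (subst rel_transfer_invariant) (simp_all add: act_simps act_def)
            finally show ?thesis
              by (simp only: generated_algebra_uminus generated_algebra.const)
          qed (use rel_transfer_short_x[of xs] long_x[OF mon(1)] zero Nil js in simp_all)
        next
          case js: (Cons j js')
          show ?thesis
          proof (cases "xs = []")
            case False
            then show ?thesis using both[OF mon(1) False mon(3)] r Nil js by simp
          next
            case True
            then show ?thesis
              using norms[OF mon(3)] rel_transfer_short_N[of js] r Nil js zero
              by (cases "p - 1 \<le> length js") simp_all
          qed
        qed
      qed
      then show ?thesis by (simp add: mc_same[OF r])
    qed
    then have "Const c * rel_transfer (multidegree_component r ?M) \<in> alg"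
      by (intro generated_algebra.mult generated_algebra.const)
    then show ?case by (simp add: mult.assoc mc_Const_mult rel_transfer_mult act_simps)
  qed
  then show ?case by (simp add: mc_same[OF less.prems(2)])
qed

text \<open>An invariant is minus its own relative transfer, which can be computed on its
  multidegree components; these remain P-invariant since the projections commute with Delta.\<close>

lemma invariants_subset_alg: "invariants m \<subseteq> alg"
proof
  fix f :: "(coord \<times> nat, 'a) mpoly" assume "f \<in> invariants m"
  then have f: "f \<in> R" "\<And>g. g \<in> SL2p \<Longrightarrow> act g f = f" by (auto simp: invariants_iff)
  have "sigma f = act (unipotent (- 1)) f"
    using act_unipotent_funpow[of 1 f] by simp
  then have "Delta f = 0" using f(2)[OF unipotent_SL2p[of "- 1"]] by (simp add: Delta_eq_0_iff)
  then have "rel_transfer (multidegree_component l f) \<in> alg" for l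
    using mc_Delta[of l f]
    by (intro rel_transfer_alg[OF poly_ring_mc[OF f(1)] mhom_mc]) (simp flip: Delta_eq_0_iff)
  then have "rel_transfer (\<Sum>l\<in>multidegree ` Poly_Mapping.keys f. multidegree_component l f) \<in> alg"
    unfolding rel_transfer_sum by (rule generated_algebra_sum)
  then have "rel_transfer f \<in> alg" by (simp only: mc_decompose)
  then have "- rel_transfer f \<in> alg" by (rule generated_algebra_uminus)
  then show "f \<in> alg" using rel_transfer_invariant[OF f(2)] by simp
qed

end

theorem theorem8p1:
  fixes p m :: nat
  assumes "prime p"
    and "CHAR('a::field) = p"
    and "m \<ge> 1"
  shows "(invariants m :: (coord \<times> nat, 'a) mpoly set) =
    generated_algebra (S_gens p m \<union> transfer ` poly_ring m)"
proof -
  interpret prime_char p m "TYPE('a)"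
    by unfold_locales (use assms in auto)
  show ?thesis
    using invariants_subset_alg generated_algebra_invariants[of "S_gens p m \<union> transfer ` R" m]
      S_gens_invariant transfer_invariant by blast
qed

end
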